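(* Let $p>q>1$ be real numbers. Then the Banach space $K(\ell_p,\ell_q)$ has no Besselian Schauder frame (and hence has no unconditional Schauder frame).
   Context: $K(E,F)$ is the Banach space of all compact linear operators $E\to F$ with the operator norm. A Schauder frame for a Banach space $E$ is a sequence $((a_n,b_n^* ))_{n\ge1}$ in $E\times E^*$ such that for every $x\in E$ the series $\sum_n b_n^*(x)a_n$ converges in norm to $x$; it is an unconditional Schauder frame if all these series converge unconditionally, and a Besselian Schauder frame if there is $B>0$ with $\sum_{n=1}^\infty|b_n^*(x)||y^*(a_n)|\le B\|x\|_E\|y^*\|_{E^*}$ for all $x\in E$, $y^*\in E^*$. *)

theory Defs
  imports "HOL-Analysis.Analysis" "HOL-Library.Function_Algebras"
begin

text \<open>
  The space \<open>\<ell>\<^sub>p\<close> depends on the real number \<open>p\<close>, so it cannot be a type. Normed spaces over \<open>'k\<close>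
  are therefore given by a carrier (a linear subspace of an ambient additive group), a scalar
  multiplication and a norm; addition is that of the ambient type, pointwise for functions.
\<close>

record ('k, 'v) nspace =
  vecs :: "'v set"
  scal :: "'k \<Rightarrow> 'v \<Rightarrow> 'v"
  vnorm :: "'v \<Rightarrow> real"

definition scalar_space :: "('k::real_normed_field, 'k) nspace" where
  "scalar_space = \<lparr>vecs = UNIV, scal = (*), vnorm = norm\<rparr>"

definition norm_topology :: "('k, 'v::ab_group_add) nspace \<Rightarrow> 'v topology" where
  "norm_topology X = Metric_space.mtopology (vecs X) (\<lambda>x y. vnorm X (x - y))"

definition lspace :: "real \<Rightarrow> ('k::real_normed_field, nat \<Rightarrow> 'k) nspace" where
  "lspace p = \<lparr>vecs = {x. summable (\<lambda>n. norm (x n) powr p)},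
               scal = (\<lambda>c x n. c * x n),
               vnorm = (\<lambda>x. (\<Sum>n. norm (x n) powr p) powr (1 / p))\<rparr>"

definition unit_ball :: "('k, 'v) nspace \<Rightarrow> 'v set" where
  "unit_ball X = {x \<in> vecs X. vnorm X x \<le> 1}"

text \<open>
  Operators are total functions of the ambient type; requiring the value \<open>0\<close> off the carrier
  makes an operator the same thing as a function on the carrier.
\<close>

definition linear_ops ::
    "('k, 'v::ab_group_add) nspace \<Rightarrow> ('k, 'w::ab_group_add) nspace \<Rightarrow> ('v \<Rightarrow> 'w) set" where
  "linear_ops X Y =
    {T. (\<forall>x\<in>vecs X. T x \<in> vecs Y) \<and>
        (\<forall>x\<in>vecs X. \<forall>y\<in>vecs X. T (x + y) = T x + T y) \<and>
        (\<forall>c. \<forall>x\<in>vecs X. T (scal X c x) = scal Y c (T x)) \<and>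
        (\<forall>x. x \<notin> vecs X \<longrightarrow> T x = 0)}"

definition op_norm :: "('k, 'v) nspace \<Rightarrow> ('k, 'w) nspace \<Rightarrow> ('v \<Rightarrow> 'w) \<Rightarrow> real" where
  "op_norm X Y T = (SUP x\<in>unit_ball X. vnorm Y (T x))"

definition bounded_ops ::
    "('k, 'v::ab_group_add) nspace \<Rightarrow> ('k, 'w::ab_group_add) nspace \<Rightarrow> ('k, 'v \<Rightarrow> 'w) nspace" where
  "bounded_ops X Y =
    \<lparr>vecs = {T \<in> linear_ops X Y. \<exists>C. \<forall>x\<in>vecs X. vnorm Y (T x) \<le> C * vnorm X x},
     scal = (\<lambda>c T x. scal Y c (T x)),
     vnorm = op_norm X Y\<rparr>"

definition compact_ops ::
    "('k, 'v::ab_group_add) nspace \<Rightarrow> ('k, 'w::ab_group_add) nspace \<Rightarrow> ('k, 'v \<Rightarrow> 'w) nspace" where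
  "compact_ops X Y =
    \<lparr>vecs = {T \<in> linear_ops X Y.
              compactin (norm_topology Y) (norm_topology Y closure_of (T ` unit_ball X))},
     scal = (\<lambda>c T x. scal Y c (T x)),
     vnorm = op_norm X Y\<rparr>"

definition dual :: "('k::real_normed_field, 'v::ab_group_add) nspace \<Rightarrow> ('k, 'v \<Rightarrow> 'k) nspace" where
  "dual X = bounded_ops X scalar_space"

definition series_converges_to ::
    "('k, 'v::ab_group_add) nspace \<Rightarrow> (nat \<Rightarrow> 'v) \<Rightarrow> 'v \<Rightarrow> bool" where
  "series_converges_to X u s \<longleftrightarrow> (\<lambda>N. vnorm X ((\<Sum>n<N. u n) - s)) \<longlonglongrightarrow> 0"

definition unconditionally_convergent ::
    "('k, 'v::ab_group_add) nspace \<Rightarrow> (nat \<Rightarrow> 'v) \<Rightarrow> bool" where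
  "unconditionally_convergent X u \<longleftrightarrow>
    (\<forall>\<pi>. bij \<pi> \<longrightarrow> (\<exists>s\<in>vecs X. series_converges_to X (u \<circ> \<pi>) s))"

definition schauder_frame ::
    "('k::real_normed_field, 'v::ab_group_add) nspace \<Rightarrow> (nat \<Rightarrow> 'v) \<Rightarrow> (nat \<Rightarrow> 'v \<Rightarrow> 'k) \<Rightarrow> bool" where
  "schauder_frame X a b \<longleftrightarrow>
    (\<forall>n. a n \<in> vecs X \<and> b n \<in> vecs (dual X)) \<and>
    (\<forall>x\<in>vecs X. series_converges_to X (\<lambda>n. scal X (b n x) (a n)) x)"

definition unconditional_schauder_frame ::
    "('k::real_normed_field, 'v::ab_group_add) nspace \<Rightarrow> (nat \<Rightarrow> 'v) \<Rightarrow> (nat \<Rightarrow> 'v \<Rightarrow> 'k) \<Rightarrow> bool" where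
  "unconditional_schauder_frame X a b \<longleftrightarrow>
    schauder_frame X a b \<and>
    (\<forall>x\<in>vecs X. unconditionally_convergent X (\<lambda>n. scal X (b n x) (a n)))"

definition besselian_schauder_frame ::
    "('k::real_normed_field, 'v::ab_group_add) nspace \<Rightarrow> (nat \<Rightarrow> 'v) \<Rightarrow> (nat \<Rightarrow> 'v \<Rightarrow> 'k) \<Rightarrow> bool" where
  "besselian_schauder_frame X a b \<longleftrightarrow>
    schauder_frame X a b \<and>
    (\<exists>B>0. \<forall>x\<in>vecs X. \<forall>y\<in>vecs (dual X).
       summable (\<lambda>n. norm (b n x) * norm (y (a n))) \<and>
       (\<Sum>n. norm (b n x) * norm (y (a n))) \<le> B * vnorm X x * vnorm (dual X) y)"

text \<open>
  The sort \<open>{real_normed_field, euclidean_space}\<close> used for the scalars covers exactly the real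
  and the complex numbers, up to isometric isomorphism: its members are the finite-dimensional
  real field extensions with a multiplicative norm.
\<close>

end

theory Submission
  imports Defs
begin

text \<open>
  If \<open>(a\<^sub>n, b\<^sub>n)\<close> is a Besselian frame with constant \<open>B\<close> and \<open>e\<^sub>i\<^sub>j\<close> are the matrix units, \<open>i, j < m\<close>, then
  evaluating the expansions of all \<open>e\<^sub>i\<^sub>j\<close> at the entry \<open>(i, j)\<close> and summing gives
  \<open>m\<^sup>2 = \<Sum>\<^sub>n \<Sum>\<^sub>i\<^sub>j b\<^sub>n(e\<^sub>i\<^sub>j) (a\<^sub>n)\<^sub>i\<^sub>j\<close>, which by Cauchy-Schwarz is at most
  \<open>\<Sum>\<^sub>n \<beta>\<^sub>n \<alpha>\<^sub>n\<close> with the two Hilbert-Schmidt norms. By Khinchine's inequality for \<open>\<epsilon>\<^sub>i \<delta>\<^sub>j\<close>, \<open>\<beta>\<^sub>n\<close> is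
  comparable with the average of \<open>\<bar>b\<^sub>n(g)\<bar>\<close> over the sign changes \<open>g = (\<epsilon>\<^sub>i w\<^sub>i\<^sub>j \<delta>\<^sub>j)\<close> of a Walsh matrix,
  and \<open>\<alpha>\<^sub>n\<close> with the average of \<open>\<bar>\<phi>(a\<^sub>n)\<bar>\<close> over the functionals \<open>\<phi>(T) = \<Sum>\<^sub>i\<^sub>j \<epsilon>\<^sub>i \<delta>\<^sub>j T\<^sub>i\<^sub>j\<close>. Hence
  \<open>m\<^sup>2 \<le> 16 B \<parallel>g\<parallel> \<parallel>\<phi>\<parallel>\<close>. Since the Walsh matrix is \<open>\<surd>m\<close> times an isometry of \<open>\<ell>\<^sub>2\<close>, comparing norms on
  \<open>m\<close> coordinates bounds \<open>\<parallel>g\<parallel> \<parallel>\<phi>\<parallel>\<close> by a power of \<open>m\<close> with exponent less than 2: a contradiction.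

  An unconditional frame is Besselian: the sums over finite index sets of the series of a fixed
  vector are bounded, so by the uniform boundedness principle they are bounded by a multiple of
  the norm of that vector.
\<close>

section \<open>Inequalities for finite sums\<close>

text \<open>If \<open>r <= s\<close>, every \<open>u i\<close> is at most the \<open>r\<close>-norm
  \<open>A\<close>, so \<open>A powr (s - r)\<close> can be pulled out and nothing is lost; if
  \<open>s < r\<close>, Hoelder's inequality costs the power \<open>1/s - 1/r\<close> of the
  cardinality. The \<open>max\<close> joins both regimes, which spares case distinctions on how
  \<open>p\<close> and \<open>q\<close> lie relative to 2.\<close>

lemma sum_powr_compare:
  fixes u :: "'i \<Rightarrow> real"
  assumes "finite S" and u: "\<And>i. i \<in> S \<Longrightarrow> 0 \<le> u i" and "0 < r" "0 < s"
  shows "(\<Sum>i\<in>S. u i powr s) powr (1/s)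
         \<le> real (card S) powr max 0 (1/s - 1/r) * (\<Sum>i\<in>S. u i powr r) powr (1/r)"
proof (cases "\<forall>i\<in>S. u i = 0")
  case True
  then have "(\<Sum>i\<in>S. u i powr s) = 0" by simp
  then show ?thesis by simp
next
  case False
  then obtain i0 where i0: "i0 \<in> S" "u i0 \<noteq> 0" by blast
  define A where "A = (\<Sum>i\<in>S. u i powr r) powr (1/r)"
  have i0r: "0 < u i0 powr r" using i0 by simp
  have Ar: "A powr r = (\<Sum>i\<in>S. u i powr r)"
    unfolding A_def using \<open>0 < r\<close> by (simp add: powr_powr sum_nonneg)
  have le: "u i powr r \<le> A powr r" if "i \<in> S" for i
    unfolding Ar using that \<open>finite S\<close> by (intro member_le_sum) auto
  have A: "0 < A"
    using less_le_trans[OF i0r le[OF i0(1)]] by (auto simp: A_def powr_eq_0_iff)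
  have n: "0 < card S" using i0 \<open>finite S\<close> by (auto simp: card_gt_0_iff)
  have key: "(\<Sum>i\<in>S. u i powr s) \<le> (real (card S) powr max 0 (1/s - 1/r) * A) powr s"
  proof (cases "r \<le> s")
    case True
    have uA: "u i \<le> A" if "i \<in> S" for i
      using le[OF that] u[OF that] A \<open>0 < r\<close> by (metis not_le powr_less_mono2 less_imp_le)
    have "(\<Sum>i\<in>S. u i powr s) \<le> (\<Sum>i\<in>S. A powr (s - r) * u i powr r)"
    proof (rule sum_mono)
      fix i assume i: "i \<in> S"
      have "u i powr s = u i powr (s - r) * u i powr r" by (simp flip: powr_add)
      also have "\<dots> \<le> A powr (s - r) * u i powr r"
        by (intro mult_right_mono powr_mono2) (use u[OF i] uA[OF i] True in auto)
      finally show "u i powr s \<le> A powr (s - r) * u i powr r" .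
    qed
    also have "\<dots> = A powr s" by (simp flip: sum_distrib_left Ar powr_add)
    also have "1/s - 1/r \<le> 0" using True \<open>0 < r\<close> \<open>0 < s\<close> by (simp add: field_simps)
    then have "max 0 (1/s - 1/r) = 0" by simp
    then have "A powr s = (real (card S) powr max 0 (1/s - 1/r) * A) powr s" using n by simp
    finally show ?thesis by simp
  next
    case False
    \<comment> \<open>Hoelder's inequality from Young's, with weights \<open>t\<close> and
      \<open>1 - t\<close> on the families \<open>(u i / A) powr r\<close> and
      \<open>1 / card S\<close>; each family sums to 1, so the right-hand sides add up to 1.\<close>
    define t where "t = s / r"
    have t: "0 < t" "t < 1" using False \<open>0 < r\<close> \<open>0 < s\<close> by (auto simp: t_def)
    have "(\<Sum>i\<in>S. (u i / A) powr s * (1 / card S) powr (1 - t))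
          \<le> (\<Sum>i\<in>S. t * (u i / A) powr r + (1 - t) * (1 / card S))"
    proof (rule sum_mono)
      fix i assume i: "i \<in> S"
      have "((u i / A) powr r) powr t * (1 / card S) powr (1 - t)
            \<le> t * (u i / A) powr r + (1 - t) * (1 / card S)"
      proof (cases "u i = 0")
        case False
        then have "0 < u i" using u[OF i] by simp
        then show ?thesis using t n A by (intro Youngs_inequality_0) auto
      qed (use t in auto)
      moreover have "r * t = s" using \<open>0 < r\<close> by (simp add: t_def)
      ultimately show "(u i / A) powr s * (1 / card S) powr (1 - t)
            \<le> t * (u i / A) powr r + (1 - t) * (1 / card S)"
        by (simp add: powr_powr)
    qed
    also have "\<dots> = t * (\<Sum>i\<in>S. (u i / A) powr r) + (1 - t)"
      using n by (simp add: sum.distrib sum_distrib_left)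
    also have "(\<Sum>i\<in>S. (u i / A) powr r) = (\<Sum>i\<in>S. u i powr r / A powr r)"
      by (simp add: powr_divide)
    also have "\<dots> = 1" using A by (simp flip: sum_divide_distrib Ar)
    finally have "(\<Sum>i\<in>S. (u i / A) powr s) * (1 / card S) powr (1 - t) \<le> 1"
      by (simp add: sum_distrib_right)
    moreover have "(\<Sum>i\<in>S. (u i / A) powr s) = (\<Sum>i\<in>S. u i powr s / A powr s)"
      by (simp add: powr_divide)
    ultimately have "(\<Sum>i\<in>S. u i powr s) \<le> A powr s * card S powr (1 - t)"
      using A n by (simp add: powr_divide field_simps flip: sum_divide_distrib)
    moreover have "1 - t = s * max 0 (1/s - 1/r)"
      using False \<open>0 < r\<close> \<open>0 < s\<close> by (simp add: t_def field_simps max_def)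
    ultimately show ?thesis
      using A by (simp add: powr_mult powr_powr mult.commute)
  qed
  have "(\<Sum>i\<in>S. u i powr s) powr (1/s)
        \<le> ((real (card S) powr max 0 (1/s - 1/r) * A) powr s) powr (1/s)"
    using key \<open>0 < s\<close> by (intro powr_mono2) (auto simp: sum_nonneg)
  also have "\<dots> = real (card S) powr max 0 (1/s - 1/r) * A"
    using A \<open>0 < s\<close> by (simp add: powr_powr)
  finally show ?thesis by (simp add: A_def)
qed

section \<open>Khinchine's inequality\<close>

text \<open>A choice of signs is encoded by the set of its positive coordinates; averages over
  independent random signs become sums over \<open>Pow I\<close> divided by
  \<open>2 ^ card I\<close>.\<close>

definition sign_of :: "'i set \<Rightarrow> 'i \<Rightarrow> real" where
  "sign_of A i = (if i \<in> A then 1 else -1)"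

lemma abs_sign_of [simp]: "\<bar>sign_of A i\<bar> = 1"
  by (simp add: sign_of_def)

lemma sum_Pow_insert:
  assumes "finite I" "k \<notin> I"
  shows "(\<Sum>A\<in>Pow (insert k I). f A) = (\<Sum>A\<in>Pow I. f A + f (insert k A))"
proof -
  have inj: "inj_on (insert k) (Pow I)"
    using \<open>k \<notin> I\<close> by (auto simp: inj_on_def)
  have "(\<Sum>A\<in>Pow (insert k I). f A) = (\<Sum>A\<in>Pow I. f A) + (\<Sum>A\<in>insert k ` Pow I. f A)"
    unfolding Pow_insert using assms by (intro sum.union_disjoint) auto
  then show ?thesis using inj by (simp add: sum.reindex sum.distrib)
qed

lemma sign_sum_insert:
  fixes c :: "'i \<Rightarrow> 'a::real_vector"
  assumes "finite I" "k \<notin> I" "A \<subseteq> I"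
  shows "(\<Sum>i\<in>insert k I. sign_of A i *\<^sub>R c i) = (\<Sum>i\<in>I. sign_of A i *\<^sub>R c i) - c k"
    and "(\<Sum>i\<in>insert k I. sign_of (insert k A) i *\<^sub>R c i) = (\<Sum>i\<in>I. sign_of A i *\<^sub>R c i) + c k"
proof -
  have "(\<Sum>i\<in>I. sign_of (insert k A) i *\<^sub>R c i) = (\<Sum>i\<in>I. sign_of A i *\<^sub>R c i)"
    using assms by (intro sum.cong) (auto simp: sign_of_def)
  moreover have "k \<notin> A" using assms by blast
  ultimately show "(\<Sum>i\<in>insert k I. sign_of A i *\<^sub>R c i) = (\<Sum>i\<in>I. sign_of A i *\<^sub>R c i) - c k"
    and "(\<Sum>i\<in>insert k I. sign_of (insert k A) i *\<^sub>R c i) = (\<Sum>i\<in>I. sign_of A i *\<^sub>R c i) + c k"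
    using assms by (simp_all add: sign_of_def)
qed

text \<open>These are the second and fourth moments of a random signed sum whose values are vectors
  indexed by \<open>J\<close>. Adding one sign turns the squared norm \<open>N\<close> into
  \<open>N + C - 2 * D\<close> or \<open>N + C + 2 * D\<close>: the terms in \<open>D\<close> cancel
  in the sum, and in the sum of squares Cauchy-Schwarz controls them by
  \<open>D\<^sup>2 <= N * C\<close>.\<close>

lemma sign_sum_moments:
  fixes c :: "'i \<Rightarrow> 'j \<Rightarrow> 'a::real_inner" and J :: "'j set"
  assumes "finite I"
  defines "N \<equiv> \<lambda>I A. \<Sum>j\<in>J. (norm (\<Sum>i\<in>I. sign_of A i *\<^sub>R c i j))\<^sup>2"
    and "S \<equiv> \<lambda>I. \<Sum>i\<in>I. \<Sum>j\<in>J. (norm (c i j))\<^sup>2"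
  shows "(\<Sum>A\<in>Pow I. N I A) = 2 ^ card I * S I"
    and "(\<Sum>A\<in>Pow I. (N I A)\<^sup>2) \<le> 2 ^ card I * (3 * (S I)\<^sup>2)"
proof -
  have "(\<Sum>A\<in>Pow I. N I A) = 2 ^ card I * S I \<and>
        (\<Sum>A\<in>Pow I. (N I A)\<^sup>2) \<le> 2 ^ card I * (3 * (S I)\<^sup>2)"
    using \<open>finite I\<close>
  proof (induction I)
    case empty
    show ?case by (simp add: N_def S_def)
  next
    case (insert k I)
    define C where "C = (\<Sum>j\<in>J. (norm (c k j))\<^sup>2)"
    have C: "0 \<le> C" unfolding C_def by (simp add: sum_nonneg)
    have SI: "0 \<le> S I" unfolding S_def by (simp add: sum_nonneg)
    have S: "S (insert k I) = S I + C" using insert by (simp add: S_def C_def)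
    define D where "D = (\<lambda>A. \<Sum>j\<in>J. (\<Sum>i\<in>I. sign_of A i *\<^sub>R c i j) \<bullet> c k j)"
    have N1: "N (insert k I) A = N I A + C - 2 * D A"
      and N2: "N (insert k I) (insert k A) = N I A + C + 2 * D A" if "A \<subseteq> I" for A
      unfolding N_def C_def D_def sign_sum_insert[OF insert(1,2) that]
      by (simp_all add: power2_norm_eq_inner inner_diff_left inner_diff_right inner_add_left inner_add_right
        sum.distrib sum_subtractf sum_distrib_left inner_commute algebra_simps)
    have D: "(D A)\<^sup>2 \<le> N I A * C" for A
    proof -
      have "\<bar>D A\<bar> \<le> (\<Sum>j\<in>J. \<bar>norm (\<Sum>i\<in>I. sign_of A i *\<^sub>R c i j)\<bar> * \<bar>norm (c k j)\<bar>)"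
        unfolding D_def by (rule order_trans[OF sum_abs]) (auto intro!: sum_mono simp: Cauchy_Schwarz_ineq2)
      also have "\<dots> \<le> L2_set (\<lambda>j. norm (\<Sum>i\<in>I. sign_of A i *\<^sub>R c i j)) J * L2_set (\<lambda>j. norm (c k j)) J"
        by (rule L2_set_mult_ineq)
      finally have "\<bar>D A\<bar>\<^sup>2 \<le> (L2_set (\<lambda>j. norm (\<Sum>i\<in>I. sign_of A i *\<^sub>R c i j)) J * L2_set (\<lambda>j. norm (c k j)) J)\<^sup>2"
        by (intro power_mono) auto
      then show ?thesis
        by (simp add: L2_set_def power_mult_distrib sum_nonneg N_def C_def)
    qed
    have "(\<Sum>A\<in>Pow (insert k I). N (insert k I) A) = (\<Sum>A\<in>Pow I. 2 * (N I A) + 2 * C)"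
      unfolding sum_Pow_insert[OF insert(1,2)] by (intro sum.cong) (auto simp: N1 N2)
    also have "\<dots> = 2 ^ card (insert k I) * S (insert k I)"
      using insert by (simp add: sum.distrib card_Pow S distrib_left flip: sum_distrib_left)
    finally have 1: "(\<Sum>A\<in>Pow (insert k I). N (insert k I) A) = 2 ^ card (insert k I) * S (insert k I)" .
    have "(\<Sum>A\<in>Pow (insert k I). (N (insert k I) A)\<^sup>2) \<le> (\<Sum>A\<in>Pow I. 2 * (N I A)\<^sup>2 + 12 * C * N I A + 2 * C\<^sup>2)"
      unfolding sum_Pow_insert[OF insert(1,2)]
    proof (rule sum_mono)
      \<comment> \<open>The two squares add up to
        \<open>2 * (N + C)\<^sup>2 + 8 * D\<^sup>2\<close>, so the coefficient of
        \<open>C * N\<close> becomes \<open>4 + 8 = 12\<close>.\<close>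
      fix A assume "A \<in> Pow I"
      then show "(N (insert k I) A)\<^sup>2 + (N (insert k I) (insert k A))\<^sup>2
          \<le> 2 * (N I A)\<^sup>2 + 12 * C * N I A + 2 * C\<^sup>2"
        using D[of A] by (simp add: N1 N2 power2_eq_square algebra_simps)
    qed
    also have "\<dots> = 2 * (\<Sum>A\<in>Pow I. (N I A)\<^sup>2) + 12 * C * (\<Sum>A\<in>Pow I. N I A) + 2 ^ card I * (2 * C\<^sup>2)"
      using insert by (simp only: sum.distrib sum_constant card_Pow of_nat_power of_nat_numeral flip: sum_distrib_left)
    also have "\<dots> \<le> 2 * (2 ^ card I * (3 * (S I)\<^sup>2)) + 12 * C * (2 ^ card I * S I) + 2 ^ card I * (2 * C\<^sup>2)"
      using insert.IH C by (intro add_mono mult_left_mono) auto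
    also have "\<dots> = 2 ^ card I * (6 * (S I)\<^sup>2 + 12 * C * S I + 2 * C\<^sup>2)" by (simp add: algebra_simps)
    \<comment> \<open>The constant 3 closes the induction: \<open>6 * (S I + C)\<^sup>2\<close> has
      exactly the cross term \<open>12 * C * S I\<close>.\<close>
    also have "\<dots> \<le> 2 ^ card I * (2 * (3 * (S I + C)\<^sup>2))"
      using C SI by (intro mult_left_mono) (auto simp: power2_eq_square algebra_simps)
    also have "\<dots> = 2 ^ card (insert k I) * (3 * (S (insert k I))\<^sup>2)" using insert by (simp add: S)
    finally show ?case using 1 by blast
  qed
  then show "(\<Sum>A\<in>Pow I. N I A) = 2 ^ card I * S I"
    and "(\<Sum>A\<in>Pow I. (N I A)\<^sup>2) \<le> 2 ^ card I * (3 * (S I)\<^sup>2)" by auto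
qed

text \<open>The second moment is known and the fourth is bounded, so rare large values cannot carry
  the second moment alone, and the first moment must be large too. Coefficients that are vectors
  indexed by \<open>J\<close> allow the inequality to be iterated.\<close>

lemma khinchine:
  fixes c :: "'i \<Rightarrow> 'j \<Rightarrow> 'a::real_inner"
  assumes "finite I"
  shows "2 ^ card I * sqrt (\<Sum>i\<in>I. \<Sum>j\<in>J. (norm (c i j))\<^sup>2)
    \<le> 2 * (\<Sum>A\<in>Pow I. sqrt (\<Sum>j\<in>J. (norm (\<Sum>i\<in>I. sign_of A i *\<^sub>R c i j))\<^sup>2))"
proof -
  define s where "s = sqrt (\<Sum>i\<in>I. \<Sum>j\<in>J. (norm (c i j))\<^sup>2)"
  define t where "t = (\<lambda>A. sqrt (\<Sum>j\<in>J. (norm (\<Sum>i\<in>I. sign_of A i *\<^sub>R c i j))\<^sup>2))"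
  have s2: "s\<^sup>2 = (\<Sum>i\<in>I. \<Sum>j\<in>J. (norm (c i j))\<^sup>2)" by (simp add: s_def sum_nonneg)
  have t2: "(t A)\<^sup>2 = (\<Sum>j\<in>J. (norm (\<Sum>i\<in>I. sign_of A i *\<^sub>R c i j))\<^sup>2)" for A
    by (simp add: t_def sum_nonneg)
  have t0: "0 \<le> t A" for A by (simp add: t_def sum_nonneg)
  have s0: "0 \<le> s" by (simp add: s_def sum_nonneg)
  note m = sign_sum_moments[OF \<open>finite I\<close>, where J = J and c = c, folded s2 t2]
  show ?thesis
  proof (cases "s = 0")
    case True
    then show ?thesis using t0 by (simp add: sum_nonneg flip: s_def t_def)
  next
    case False
    then have s: "0 < s" using s0 by simp
    \<comment> \<open>The quartic is tangent to the identity at \<open>t = 2 s\<close>.\<close>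
    have pw: "12 * s\<^sup>2 * (t A)\<^sup>2 - ((t A)\<^sup>2)\<^sup>2 \<le> 16 * s ^ 3 * t A" for A
    proof -
      have "0 \<le> t A * ((t A - 2 * s)\<^sup>2 * (t A + 4 * s))"
        using t0[of A] s by simp
      also have "\<dots> = 16 * s ^ 3 * t A - (12 * s\<^sup>2 * (t A)\<^sup>2 - ((t A)\<^sup>2)\<^sup>2)"
        by (simp add: power2_eq_square power3_eq_cube algebra_simps)
      finally show ?thesis by simp
    qed
    \<comment> \<open>The mean of
      \<open>12 * s\<^sup>2 * (t A)\<^sup>2 - ((t A)\<^sup>2)\<^sup>2\<close> is at least
      \<open>12 * s ^ 4 - 3 * s ^ 4 = 9 * s ^ 4\<close>. The resulting constant
      \<open>16 / 9\<close> is rounded up to 2.\<close>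
    have "9 * s ^ 3 * (2 ^ card I * s) = 12 * s\<^sup>2 * (2 ^ card I * s\<^sup>2) - 2 ^ card I * (3 * (s\<^sup>2)\<^sup>2)"
      by (simp add: power2_eq_square power3_eq_cube algebra_simps)
    also have "\<dots> \<le> 12 * s\<^sup>2 * (\<Sum>A\<in>Pow I. (t A)\<^sup>2) - (\<Sum>A\<in>Pow I. ((t A)\<^sup>2)\<^sup>2)"
      using m by simp
    also have "\<dots> = (\<Sum>A\<in>Pow I. 12 * s\<^sup>2 * (t A)\<^sup>2 - ((t A)\<^sup>2)\<^sup>2)"
      by (simp add: sum_subtractf sum_distrib_left)
    also have "\<dots> \<le> (\<Sum>A\<in>Pow I. 16 * s ^ 3 * t A)" by (intro sum_mono pw)
    also have "\<dots> \<le> 9 * s ^ 3 * (2 * (\<Sum>A\<in>Pow I. t A))"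
      using s t0 by (simp add: sum_nonneg flip: sum_distrib_left)
    finally show ?thesis
      using s by (simp add: mult.commute flip: s_def) (simp add: t_def mult.commute)
  qed
qed

text \<open>Khinchine's inequality is used for the row signs, where the coefficients are the vectors
  \<open>c i\<close>, and then, for each fixed \<open>A\<close>, for the column signs with
  \<open>J = {()}\<close>. The constants multiply to \<open>2 * 2 = 4\<close>.\<close>

lemma khinchine_double:
  fixes c :: "'i \<Rightarrow> 'j \<Rightarrow> 'a::real_inner"
  assumes "finite I" "finite J"
  shows "2 ^ card I * 2 ^ card J * sqrt (\<Sum>i\<in>I. \<Sum>j\<in>J. (norm (c i j))\<^sup>2)
    \<le> 4 * (\<Sum>A\<in>Pow I. \<Sum>A'\<in>Pow J. norm (\<Sum>i\<in>I. \<Sum>j\<in>J. (sign_of A i * sign_of A' j) *\<^sub>R c i j))"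
proof -
  have *: "2 ^ card J * sqrt (\<Sum>j\<in>J. (norm (\<Sum>i\<in>I. sign_of A i *\<^sub>R c i j))\<^sup>2)
      \<le> 2 * (\<Sum>A'\<in>Pow J. norm (\<Sum>i\<in>I. \<Sum>j\<in>J. (sign_of A i * sign_of A' j) *\<^sub>R c i j))" for A
  proof -
    have "(\<Sum>j\<in>J. sign_of A' j *\<^sub>R (\<Sum>i\<in>I. sign_of A i *\<^sub>R c i j)) =
        (\<Sum>i\<in>I. \<Sum>j\<in>J. (sign_of A i * sign_of A' j) *\<^sub>R c i j)" for A'
      by (subst sum.swap) (simp add: scaleR_sum_right mult.commute)
    then show ?thesis
      using khinchine[OF \<open>finite J\<close>, where J = "{()}" and c = "\<lambda>j _. \<Sum>i\<in>I. sign_of A i *\<^sub>R c i j"] by simp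
  qed
  have "2 ^ card J * (2 ^ card I * sqrt (\<Sum>i\<in>I. \<Sum>j\<in>J. (norm (c i j))\<^sup>2))
    \<le> 2 ^ card J * (2 * (\<Sum>A\<in>Pow I. sqrt (\<Sum>j\<in>J. (norm (\<Sum>i\<in>I. sign_of A i *\<^sub>R c i j))\<^sup>2)))"
    by (intro mult_left_mono khinchine assms) auto
  also have "\<dots> = 2 * (\<Sum>A\<in>Pow I. 2 ^ card J * sqrt (\<Sum>j\<in>J. (norm (\<Sum>i\<in>I. sign_of A i *\<^sub>R c i j))\<^sup>2))"
    by (simp add: sum_distrib_left mult_ac)
  also have "\<dots> \<le> 2 * (\<Sum>A\<in>Pow I. 2 * (\<Sum>A'\<in>Pow J. norm (\<Sum>i\<in>I. \<Sum>j\<in>J. (sign_of A i * sign_of A' j) *\<^sub>R c i j)))"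
    by (intro mult_left_mono sum_mono *) auto
  finally show ?thesis by (simp add: sum_distrib_left mult_ac)
qed

section \<open>Walsh matrices\<close>

text \<open>Sylvester's construction of Hadamard matrices: doubling the order puts the previous
  matrix into four blocks and reverses the sign of the lower right one. The order is
  \<open>2 ^ k\<close>, so the relevant indices are those below it.\<close>

fun walsh :: "nat \<Rightarrow> nat \<Rightarrow> nat \<Rightarrow> real" where
  "walsh 0 i j = 1"
| "walsh (Suc k) i j =
    (if 2 ^ k \<le> i \<and> 2 ^ k \<le> j then -1 else 1) * walsh k (i mod 2 ^ k) (j mod 2 ^ k)"

lemma abs_walsh [simp]: "\<bar>walsh k i j\<bar> = 1"
  by (induction k arbitrary: i j) (auto simp: abs_mult)

lemma sum_lessThan_double:
  fixes f :: "nat \<Rightarrow> 'a::comm_monoid_add"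
  shows "(\<Sum>i<2 * n. f i) = (\<Sum>i<n. f i + f (i + n))"
proof -
  have "(\<Sum>i=n..<2*n. f i) = (\<Sum>i=0..<n. f (i + n))"
    using sum.shift_bounds_nat_ivl[of f 0 n n] by (simp only: mult_2 add_0)
  moreover have "(\<Sum>i=0..<n. f i) + (\<Sum>i=n..<2*n. f i) = (\<Sum>i=0..<2*n. f i)"
    by (rule sum.atLeastLessThan_concat) auto
  ultimately show ?thesis by (simp only: lessThan_atLeast0 sum.distrib)
qed

text \<open>With \<open>x\<close> cut into halves, rows \<open>i\<close> and
  \<open>i + 2 ^ k\<close> produce the sum and the difference of the same two vectors; the
  parallelogram law gives a factor 2 per induction step.\<close>

lemma walsh_isometry:
  fixes x :: "nat \<Rightarrow> 'a::real_inner"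
  shows "(\<Sum>i<2^k. (norm (\<Sum>j<2^k. walsh k i j *\<^sub>R x j))\<^sup>2) = 2 ^ k * (\<Sum>j<2^k. (norm (x j))\<^sup>2)"
proof (induction k arbitrary: x)
  case 0
  show ?case by simp
next
  case (Suc k)
  let ?n = "2 ^ k :: nat"
  let ?f = "\<lambda>y i. \<Sum>j<?n. walsh k i j *\<^sub>R y j"
  define y where "y = (\<lambda>j. x (j + ?n))"
  have low: "(\<Sum>j<2^Suc k. walsh (Suc k) i j *\<^sub>R x j) = ?f x i + ?f y i"
    and high: "(\<Sum>j<2^Suc k. walsh (Suc k) (i + ?n) j *\<^sub>R x j) = ?f x i - ?f y i" if "i < ?n" for i
    unfolding power_Suc sum_lessThan_double using that
    by (auto simp: y_def simp flip: sum_subtractf sum.distrib intro!: sum.cong)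
  have "(\<Sum>i<2^Suc k. (norm (\<Sum>j<2^Suc k. walsh (Suc k) i j *\<^sub>R x j))\<^sup>2)
     = (\<Sum>i<?n. (norm (?f x i + ?f y i))\<^sup>2 + (norm (?f x i - ?f y i))\<^sup>2)"
    unfolding power_Suc[of "2::nat" k] sum_lessThan_double
    by (intro sum.cong refl) (simp add: low[unfolded power_Suc sum_lessThan_double] high[unfolded power_Suc sum_lessThan_double] del: walsh.simps)
  also have "\<dots> = (\<Sum>i<?n. 2 * (norm (?f x i))\<^sup>2 + 2 * (norm (?f y i))\<^sup>2)"
    by (intro sum.cong refl) (simp add: power2_norm_eq_inner inner_add_left inner_add_right inner_diff_left inner_diff_right)
  also have "\<dots> = 2 * (2 ^ k * (\<Sum>j<?n. (norm (x j))\<^sup>2)) + 2 * (2 ^ k * (\<Sum>j<?n. (norm (y j))\<^sup>2))"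
    by (simp add: sum.distrib Suc flip: sum_distrib_left)
  also have "\<dots> = 2 ^ Suc k * (\<Sum>j<2^Suc k. (norm (x j))\<^sup>2)"
    unfolding power_Suc[of "2::nat" k] sum_lessThan_double by (simp add: y_def sum.distrib algebra_simps)
  finally show ?case .
qed

section \<open>Normed spaces given by a carrier\<close>

text \<open>The scalar laws hold on the whole ambient type and the norm laws on the carrier, so the
  carrier is a \<open>subspace\<close> of a \<open>module\<close>. Nonnegativity of the norm is
  derived from the triangle inequality for \<open>x\<close> and \<open>- x\<close>.\<close>

locale normed_nspace = module "scal X"
  for X :: "('k::real_normed_field, 'v::ab_group_add) nspace" +
  assumes subspace_vecs: "subspace (vecs X)"
    and vnorm_eq_0: "x \<in> vecs X \<Longrightarrow> vnorm X x = 0 \<Longrightarrow> x = 0"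
    and vnorm_triangle: "x \<in> vecs X \<Longrightarrow> y \<in> vecs X \<Longrightarrow> vnorm X (x + y) \<le> vnorm X x + vnorm X y"
    and vnorm_scal: "x \<in> vecs X \<Longrightarrow> vnorm X (scal X c x) = norm c * vnorm X x"
begin

lemmas zero_vecs [simp, intro] = subspace_0[OF subspace_vecs]
lemmas add_vecs [simp, intro] = subspace_add[OF subspace_vecs]
lemmas scal_vecs [simp, intro] = subspace_scale[OF subspace_vecs]
lemmas minus_vecs [simp, intro] = subspace_neg[OF subspace_vecs]
lemmas diff_vecs [simp, intro] = subspace_diff[OF subspace_vecs]
lemmas sum_vecs [intro] = subspace_sum[OF subspace_vecs]

lemma vnorm_zero [simp]: "vnorm X 0 = 0"
  using vnorm_scal[of 0 0] by simp

lemma vnorm_minus: "x \<in> vecs X \<Longrightarrow> vnorm X (- x) = vnorm X x"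
  using vnorm_scal[of x "-1"] by simp

lemma vnorm_nonneg [simp]: "x \<in> vecs X \<Longrightarrow> 0 \<le> vnorm X x"
  using vnorm_triangle[of x "-x"] vnorm_minus[of x] by simp

lemma vnorm_diff_commute: "x \<in> vecs X \<Longrightarrow> y \<in> vecs X \<Longrightarrow> vnorm X (x - y) = vnorm X (y - x)"
  using vnorm_minus[of "x - y"] by simp

lemma vnorm_triangle_diff: "x \<in> vecs X \<Longrightarrow> y \<in> vecs X \<Longrightarrow> vnorm X (x - y) \<le> vnorm X x + vnorm X y"
  using vnorm_triangle[of x "-y"] vnorm_minus[of y] by simp

lemma vnorm_triangle_via:
  "x \<in> vecs X \<Longrightarrow> y \<in> vecs X \<Longrightarrow> z \<in> vecs X \<Longrightarrow> vnorm X (x - z) \<le> vnorm X (x - y) + vnorm X (y - z)"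
  using vnorm_triangle[of "x - y" "y - z"] by simp

lemma vnorm_sum: "(\<And>i. i \<in> A \<Longrightarrow> f i \<in> vecs X) \<Longrightarrow> vnorm X (sum f A) \<le> (\<Sum>i\<in>A. vnorm X (f i))"
proof (induction A rule: infinite_finite_induct)
  case (insert i A)
  then have "sum f A \<in> vecs X" by (intro sum_vecs) auto
  then show ?case using insert vnorm_triangle[of "f i" "sum f A"] by auto
qed auto

lemma zero_unit_ball: "0 \<in> unit_ball X"
  by (simp add: unit_ball_def)

definition converges :: "(nat \<Rightarrow> 'v) \<Rightarrow> 'v \<Rightarrow> bool" where
  "converges u a \<longleftrightarrow> (\<lambda>n. vnorm X (u n - a)) \<longlonglongrightarrow> 0"

definition cauchy :: "(nat \<Rightarrow> 'v) \<Rightarrow> bool" where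
  "cauchy u \<longleftrightarrow> (\<forall>e>0. \<exists>N. \<forall>m\<ge>N. \<forall>n\<ge>N. vnorm X (u m - u n) < e)"

definition complete_nspace :: bool where
  "complete_nspace \<longleftrightarrow> (\<forall>u. range u \<subseteq> vecs X \<longrightarrow> cauchy u \<longrightarrow> (\<exists>a\<in>vecs X. converges u a))"

lemma converges_unique:
  assumes "\<And>n. u n \<in> vecs X" "a \<in> vecs X" "b \<in> vecs X" "converges u a" "converges u b"
  shows "a = b"
proof -
  have "(\<lambda>n. vnorm X (u n - a) + vnorm X (u n - b)) \<longlonglongrightarrow> 0 + 0"
    using assms unfolding converges_def by (intro tendsto_add)
  moreover have "vnorm X (a - b) \<le> vnorm X (u n - a) + vnorm X (u n - b)" for n
    using vnorm_triangle_via[of a "u n" b] assms vnorm_diff_commute[of a "u n"] by simp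
  ultimately have "vnorm X (a - b) \<le> 0"
    by (intro LIMSEQ_le_const) auto
  then have "vnorm X (a - b) = 0" using assms by (intro order_antisym vnorm_nonneg) auto
  then have "a - b = 0" using assms by (intro vnorm_eq_0) auto
  then show ?thesis by simp
qed

lemma converges_add:
  assumes "\<And>n. u n \<in> vecs X" "\<And>n. v n \<in> vecs X" "a \<in> vecs X" "b \<in> vecs X" "converges u a" "converges v b"
  shows "converges (\<lambda>n. u n + v n) (a + b)"
  unfolding converges_def
proof (rule tendsto_sandwich[OF _ _ tendsto_const])
  show "(\<lambda>n. vnorm X (u n - a) + vnorm X (v n - b)) \<longlonglongrightarrow> 0"
    using tendsto_add[OF assms(5,6)[unfolded converges_def]] by simp
  show "\<forall>\<^sub>F n in sequentially. vnorm X (u n + v n - (a + b)) \<le> vnorm X (u n - a) + vnorm X (v n - b)"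
    using vnorm_triangle assms by (intro always_eventually allI) (metis add_diff_add diff_vecs)
qed (use assms in auto)

lemma converges_scal:
  assumes "\<And>n. u n \<in> vecs X" "a \<in> vecs X" "converges u a"
  shows "converges (\<lambda>n. scal X c (u n)) (scal X c a)"
proof -
  have "vnorm X (scal X c (u n) - scal X c a) = norm c * vnorm X (u n - a)" for n
    using assms by (simp add: vnorm_scal flip: scale_right_diff_distrib)
  then show ?thesis
    using assms tendsto_mult_left[of _ 0 _ "norm c"] unfolding converges_def by simp
qed

lemma converges_imp_cauchy:
  assumes "\<And>n. u n \<in> vecs X" "a \<in> vecs X" "converges u a"
  shows "cauchy u"
  unfolding cauchy_def
proof (intro allI impI)
  fix e :: real assume "0 < e"
  then have "\<forall>\<^sub>F n in sequentially. vnorm X (u n - a) < e/2"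
    using assms(3) unfolding converges_def by (intro order_tendstoD) auto
  then obtain N where N: "\<And>n. n \<ge> N \<Longrightarrow> vnorm X (u n - a) < e/2"
    by (auto simp: eventually_sequentially)
  have "vnorm X (u m - u n) < e" if "m \<ge> N" "n \<ge> N" for m n
    using vnorm_triangle_via[of "u m" a "u n"] vnorm_diff_commute[of a "u n"] N[OF that(1)] N[OF that(2)] assms(1,2)
    by simp
  then show "\<exists>N. \<forall>m\<ge>N. \<forall>n\<ge>N. vnorm X (u m - u n) < e" by blast
qed

text \<open>Banach-Steinhaus by Baire's theorem, phrased for seminorms because it will be applied to
  norms of finite partial sums. Some sublevel set \<open>A n\<close> contains a ball, and
  homogeneity carries the bound from small vectors to all.\<close>

lemma uniform_boundedness:
  assumes "complete_nspace"
    and add: "\<And>i x y. x \<in> vecs X \<Longrightarrow> y \<in> vecs X \<Longrightarrow> s i (x + y) \<le> s i x + s i y"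
    and scal: "\<And>i c x. x \<in> vecs X \<Longrightarrow> s i (scal X c x) = norm c * s i x"
    and cont: "\<And>i. \<exists>C. \<forall>x\<in>vecs X. s i x \<le> C * vnorm X x"
    and bdd: "\<And>x. x \<in> vecs X \<Longrightarrow> \<exists>K. \<forall>i. s i x \<le> K"
  shows "\<exists>B>0. \<forall>i. \<forall>x\<in>vecs X. s i x \<le> B * vnorm X x"
proof -
  have minus: "s i (- x) = s i x" if "x \<in> vecs X" for i x
    using scal[OF that, of i "-1"] by simp
  \<comment> \<open>The default 0 off the carrier matters: \<open>Metric_space\<close> demands
    nonnegativity and symmetry at all points of the type.\<close>
  define d where "d = (\<lambda>x y. if x \<in> vecs X \<and> y \<in> vecs X then vnorm X (x - y) else 0)"
  interpret M: Metric_space "vecs X" d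
  proof
    fix x y
    show "0 \<le> d x y" by (simp add: d_def)
    show "d x y = d y x" using vnorm_diff_commute[of x y] by (simp add: d_def)
    show "d x y = 0 \<longleftrightarrow> x = y" if "x \<in> vecs X" "y \<in> vecs X"
      using that vnorm_eq_0[of "x - y"] diff_vecs[OF that] by (auto simp: d_def simp del: diff_vecs)
    show "d x z \<le> d x y + d y z" if "x \<in> vecs X" "y \<in> vecs X" "z \<in> vecs X" for z
      using vnorm_triangle_via[OF that] that by (simp add: d_def)
  qed
  have "M.mcomplete"
    unfolding M.mcomplete_def
  proof (intro allI impI)
    fix u assume u: "M.MCauchy u"
    then have "range u \<subseteq> vecs X" by (simp add: M.MCauchy_def)
    then have "d (u m) (u n) = vnorm X (u m - u n)" for m n by (auto simp: d_def)
    then have "cauchy u" using u by (simp add: M.MCauchy_def cauchy_def)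
    then obtain a where "a \<in> vecs X" "converges u a"
      using \<open>complete_nspace\<close> \<open>range u \<subseteq> vecs X\<close> unfolding complete_nspace_def by blast
    moreover have "(\<lambda>n. d (u n) a) = (\<lambda>n. vnorm X (u n - a))"
      using \<open>a \<in> vecs X\<close> \<open>range u \<subseteq> vecs X\<close> by (auto simp: d_def image_subset_iff)
    ultimately have "limitin M.mtopology u a sequentially"
      using \<open>range u \<subseteq> vecs X\<close> by (auto simp: M.limitin_metric_dist_null converges_def image_subset_iff)
    then show "\<exists>a. limitin M.mtopology u a sequentially" ..
  qed
  define A where "A = (\<lambda>n::nat. {x \<in> vecs X. \<forall>i. s i x \<le> n})"
  have closed: "closedin M.mtopology (A n)" for n
    unfolding M.closedin_metric
  proof (intro conjI allI impI)
    show "A n \<subseteq> vecs X" by (auto simp: A_def)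
    fix x assume x: "x \<in> vecs X - A n"
    then obtain i where i: "n < s i x" by (auto simp: A_def not_le)
    obtain C where C: "\<And>x. x \<in> vecs X \<Longrightarrow> s i x \<le> C * vnorm X x" using cont by blast
    \<comment> \<open>By subadditivity \<open>s i\<close> varies by at most
      \<open>\<bar>C\<bar>\<close> times the distance, so it cannot drop to \<open>n\<close> within
      this radius; the added 1 keeps the denominator positive.\<close>
    have "disjnt (A n) (M.mball x ((s i x - n) / (\<bar>C\<bar> + 1)))"
      unfolding disjnt_def
    proof (rule ccontr)
      assume "A n \<inter> M.mball x ((s i x - n) / (\<bar>C\<bar> + 1)) \<noteq> {}"
      then obtain y where y: "y \<in> A n" "y \<in> vecs X" "d x y < (s i x - n) / (\<bar>C\<bar> + 1)" by auto
      have xy: "0 \<le> vnorm X (x - y)" using x y by simp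
      have "s i x \<le> s i (x - y) + s i y" using add[of "x - y" y i] x y by simp
      also have "\<dots> \<le> C * vnorm X (x - y) + n" using C[of "x - y"] x y by (auto simp: A_def intro!: add_mono)
      also have "\<dots> \<le> (\<bar>C\<bar> + 1) * vnorm X (x - y) + n" using xy by (intro add_mono mult_right_mono) auto
      also have "\<dots> < s i x" using y x by (simp add: d_def field_simps)
      finally show False by simp
    qed
    then show "\<exists>r>0. disjnt (A n) (M.mball x r)" using i by (intro exI[of _ "(s i x - n) / (\<bar>C\<bar> + 1)"]) auto
  qed
  have "vecs X \<subseteq> (\<Union>n. A n)"
  proof
    fix x assume x: "x \<in> vecs X"
    then obtain K where "\<And>i. s i x \<le> K" using bdd by blast
    moreover obtain n :: nat where "K \<le> n" using real_arch_simple by blast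
    ultimately show "x \<in> (\<Union>n. A n)" using x by (auto simp: A_def intro: order_trans)
  qed
  then have "vecs X = (\<Union>n. A n)" by (auto simp: A_def)
  then have ne: "M.mtopology interior_of (\<Union>n. A n) \<noteq> {}"
    using interior_of_topspace[of M.mtopology] zero_vecs by (metis M.topspace_mtopology empty_iff)
  have "\<exists>n. M.mtopology interior_of A n \<noteq> {}"
    using M.metric_Baire_category_alt[OF \<open>M.mcomplete\<close>, of "range A"] closed ne by auto
  then obtain n x0 where "x0 \<in> M.mtopology interior_of A n" by blast
  then obtain r where r: "0 < r" "M.mball x0 r \<subseteq> A n" "x0 \<in> vecs X"
    unfolding M.metric_interior_of by auto
  \<comment> \<open>Writing \<open>z\<close> as the difference of \<open>x0 + z\<close> and
    \<open>x0\<close>, both in \<open>A n\<close>, recentres the ball at 0 and doubles the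
    bound.\<close>
  have small: "s i z \<le> 2 * n" if "z \<in> vecs X" "vnorm X z < r" for i z
  proof -
    have "x0 + z \<in> M.mball x0 r" "x0 \<in> M.mball x0 r"
      unfolding M.in_mball using that r(1,3) vnorm_minus[of z] by (auto simp: d_def)
    then have "s i (x0 + z) \<le> n" "s i x0 \<le> n" using r by (auto simp: A_def)
    moreover have "s i z \<le> s i (x0 + z) + s i x0"
      using add[of "x0 + z" "- x0" i] minus[of x0 i] that r by simp
    ultimately show ?thesis by simp
  qed
  \<comment> \<open>Scaling \<open>x\<close> to norm \<open>r / 2\<close> stays inside the open ball
    and gives the factor \<open>4 * n / r\<close>; the added 1 makes the constant positive even for
    \<open>n = 0\<close>.\<close>
  have "s i x \<le> (4 * n / r + 1) * vnorm X x" if x: "x \<in> vecs X" for i x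
  proof (cases "vnorm X x = 0")
    case True
    then have "x = 0" using vnorm_eq_0 x by blast
    then show ?thesis using scal[of 0 i 0] by simp
  next
    case False
    then have pos: "0 < vnorm X x" using vnorm_nonneg[OF x] by linarith
    define t where "t = r / (2 * vnorm X x)"
    have t: "0 < t" using pos r by (simp add: t_def)
    have tx: "t * vnorm X x < r" using pos r by (simp add: t_def)
    have "norm (of_real t :: 'k) = t" using t by (simp only: norm_of_real)
    then have "t * s i x \<le> 2 * n"
      using small[of "scal X (of_real t) x" i] x tx scal[OF x, of i "of_real t"] vnorm_scal[OF x, of "of_real t"]
      by simp
    then have "s i x \<le> 4 * n / r * vnorm X x" using pos r by (simp add: t_def field_simps)
    also have "\<dots> \<le> (4 * n / r + 1) * vnorm X x" using pos by (simp add: algebra_simps)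
    finally show ?thesis .
  qed
  then show ?thesis using r by (intro exI[of _ "4 * n / r + 1"]) (auto intro: add_nonneg_pos)
qed

end

lemma normed_nspace_scalar: "normed_nspace (scalar_space :: ('k::real_normed_field, 'k) nspace)"
proof -
  interpret module "scal (scalar_space :: ('k, 'k) nspace)"
    by standard (auto simp: scalar_space_def algebra_simps)
  show ?thesis
    by standard (auto simp: scalar_space_def norm_mult norm_triangle_ineq subspace_def)
qed

section \<open>Spaces of operators\<close>

locale normed_pair = X: normed_nspace X + Y: normed_nspace Y
  for X :: "('k::real_normed_field, 'v::ab_group_add) nspace"
    and Y :: "('k, 'w::ab_group_add) nspace"
begin

lemma linear_opsD:
  assumes "T \<in> linear_ops X Y"
  shows "x \<in> vecs X \<Longrightarrow> T x \<in> vecs Y"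
    and "x \<in> vecs X \<Longrightarrow> y \<in> vecs X \<Longrightarrow> T (x + y) = T x + T y"
    and "x \<in> vecs X \<Longrightarrow> T (scal X c x) = scal Y c (T x)"
    and "x \<notin> vecs X \<Longrightarrow> T x = 0"
  using assms by (auto simp: linear_ops_def)

lemma linear_ops_zero: "T \<in> linear_ops X Y \<Longrightarrow> T 0 = 0"
  using linear_opsD(3)[of T 0 0] by simp

lemma linear_ops_vecs: "T \<in> linear_ops X Y \<Longrightarrow> T x \<in> vecs Y"
  using linear_opsD(1,4)[of T x] by (cases "x \<in> vecs X") auto

lemma linear_ops_sum:
  assumes T: "T \<in> linear_ops X Y" and "\<And>i. i \<in> A \<Longrightarrow> f i \<in> vecs X"
  shows "T (sum f A) = (\<Sum>i\<in>A. T (f i))"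
  using assms(2)
proof (induction A rule: infinite_finite_induct)
  case (insert i A)
  then have "sum f A \<in> vecs X" by (intro X.sum_vecs) auto
  then show ?case using insert linear_opsD(2)[OF T, of "f i" "sum f A"] by auto
qed (auto simp: linear_ops_zero[OF T])

lemma linear_ops_subspace:
  shows "0 \<in> linear_ops X Y"
    and "S \<in> linear_ops X Y \<Longrightarrow> T \<in> linear_ops X Y \<Longrightarrow> S + T \<in> linear_ops X Y"
    and "T \<in> linear_ops X Y \<Longrightarrow> (\<lambda>x. scal Y c (T x)) \<in> linear_ops X Y"
  by (auto simp: linear_ops_def algebra_simps mult.commute)

lemma bounded_on_ball:
  assumes T: "T \<in> linear_ops X Y" and ball: "\<And>x. x \<in> unit_ball X \<Longrightarrow> vnorm Y (T x) \<le> C"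
    and x: "x \<in> vecs X"
  shows "vnorm Y (T x) \<le> C * vnorm X x"
proof (cases "vnorm X x = 0")
  case True
  then show ?thesis using X.vnorm_eq_0[OF x] linear_ops_zero[OF T] by simp
next
  case False
  then have pos: "0 < vnorm X x" using X.vnorm_nonneg[OF x] by linarith
  define c :: 'k where "c = of_real (1 / vnorm X x)"
  have c: "norm c = 1 / vnorm X x" using pos by (simp only: c_def norm_of_real) simp
  have "vnorm X (scal X c x) = 1" using pos X.vnorm_scal[OF x, of c] by (simp add: c)
  then have "vnorm Y (T (scal X c x)) \<le> C"
    using x by (intro ball) (simp add: unit_ball_def)
  then show ?thesis
    using pos linear_opsD(1,3)[OF T x] by (simp add: Y.vnorm_scal c field_simps)
qed

text \<open>\<open>op_norm\<close> is a supremum of reals, hence an upper bound only if the set is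
  bounded above; the constant \<open>C\<close> from membership supplies this.\<close>

lemma bounded_opsD:
  assumes "T \<in> vecs (bounded_ops X Y)"
  shows "T \<in> linear_ops X Y" and "x \<in> vecs X \<Longrightarrow> vnorm Y (T x) \<le> op_norm X Y T * vnorm X x"
    and "0 \<le> op_norm X Y T"
proof -
  show T: "T \<in> linear_ops X Y" using assms by (simp add: bounded_ops_def)
  obtain C where C: "\<And>x. x \<in> vecs X \<Longrightarrow> vnorm Y (T x) \<le> C * vnorm X x"
    using assms by (auto simp: bounded_ops_def)
  have "vnorm Y (T x) \<le> \<bar>C\<bar>" if "x \<in> unit_ball X" for x
  proof -
    have "vnorm Y (T x) \<le> C * vnorm X x" using C that by (simp add: unit_ball_def)
    also have "\<dots> \<le> \<bar>C\<bar> * 1" using that by (intro mult_mono) (auto simp: unit_ball_def)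
    finally show ?thesis by simp
  qed
  then have bdd: "bdd_above ((\<lambda>x. vnorm Y (T x)) ` unit_ball X)" by (auto intro!: bdd_aboveI2)
  then have ball: "vnorm Y (T x) \<le> op_norm X Y T" if "x \<in> unit_ball X" for x
    unfolding op_norm_def using that by (intro cSUP_upper)
  show 0: "0 \<le> op_norm X Y T"
    using ball[OF X.zero_unit_ball] linear_ops_zero[OF T] by simp
  show "vnorm Y (T x) \<le> op_norm X Y T * vnorm X x" if x: "x \<in> vecs X"
    by (rule bounded_on_ball[OF T ball x])
qed

lemma op_norm_le:
  assumes "0 \<le> C" "\<And>x. x \<in> vecs X \<Longrightarrow> vnorm Y (T x) \<le> C * vnorm X x"
  shows "op_norm X Y T \<le> C"
  unfolding op_norm_def
proof (rule cSUP_least)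
  show "unit_ball X \<noteq> {}" using X.zero_unit_ball by blast
  show "vnorm Y (T x) \<le> C" if "x \<in> unit_ball X" for x
    using assms(2)[of x] that mult_left_mono[OF _ \<open>0 \<le> C\<close>, of "vnorm X x" 1]
    by (auto simp: unit_ball_def)
qed

lemma bounded_opsI:
  "T \<in> linear_ops X Y \<Longrightarrow> (\<And>x. x \<in> vecs X \<Longrightarrow> vnorm Y (T x) \<le> C * vnorm X x) \<Longrightarrow> T \<in> vecs (bounded_ops X Y)"
  by (auto simp: bounded_ops_def)

text \<open>Formulated for any space \<open>Z\<close> of bounded operators with the operator norm,
  so that it serves both \<open>bounded_ops\<close> and \<open>compact_ops\<close>. Definiteness
  holds for the total functions because operators vanish off the carrier.\<close>

lemma normed_operators:
  assumes sub: "vecs Z \<subseteq> vecs (bounded_ops X Y)" and scal: "scal Z = (\<lambda>c T x. scal Y c (T x))"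
    and vnorm: "vnorm Z = op_norm X Y" and zero: "0 \<in> vecs Z"
    and add: "\<And>S T. S \<in> vecs Z \<Longrightarrow> T \<in> vecs Z \<Longrightarrow> S + T \<in> vecs Z"
    and scl: "\<And>c T. T \<in> vecs Z \<Longrightarrow> (\<lambda>x. scal Y c (T x)) \<in> vecs Z"
  shows "normed_nspace Z"
proof -
  interpret module "scal Z"
    by standard (auto simp: scal fun_eq_iff algebra_simps)
  show ?thesis
  proof
    show "subspace (vecs Z)" by (intro subspaceI zero add) (auto simp: scal scl)
    show "T = 0" if T: "T \<in> vecs Z" and n0: "vnorm Z T = 0" for T
    proof
      fix x
      have B: "T \<in> vecs (bounded_ops X Y)" using T sub by blast
      show "T x = 0 x"
      proof (cases "x \<in> vecs X")
        case True
        have "vnorm Y (T x) \<le> 0" using bounded_opsD(2)[OF B True] n0 by (simp add: vnorm)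
        moreover have Tx: "T x \<in> vecs Y" using bounded_opsD(1)[OF B] True linear_opsD(1) by blast
        ultimately have "vnorm Y (T x) = 0" using Y.vnorm_nonneg[OF Tx] by linarith
        then show ?thesis using Y.vnorm_eq_0[OF Tx] by simp
      qed (use linear_opsD(4)[OF bounded_opsD(1)[OF B]] in auto)
    qed
    show "vnorm Z (S + T) \<le> vnorm Z S + vnorm Z T" if "S \<in> vecs Z" "T \<in> vecs Z" for S T
      unfolding vnorm
    proof (rule op_norm_le)
      have B: "S \<in> vecs (bounded_ops X Y)" "T \<in> vecs (bounded_ops X Y)" using that sub by auto
      note D = bounded_opsD[OF B(1)] bounded_opsD[OF B(2)]
      show "0 \<le> op_norm X Y S + op_norm X Y T" using D by simp
      show "vnorm Y ((S + T) x) \<le> (op_norm X Y S + op_norm X Y T) * vnorm X x" if x: "x \<in> vecs X" for x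
        using D(2,5)[OF x] Y.vnorm_triangle[of "S x" "T x"] linear_opsD(1)[OF D(1) x] linear_opsD(1)[OF D(4) x]
        by (simp add: algebra_simps)
    qed
    have le: "vnorm Z (scal Z c T) \<le> norm c * vnorm Z T" if "T \<in> vecs Z" for c T
      unfolding vnorm
    proof (rule op_norm_le)
      have B: "T \<in> vecs (bounded_ops X Y)" using that sub by auto
      note D = bounded_opsD[OF B]
      show "0 \<le> norm c * op_norm X Y T" using D by simp
      show "vnorm Y (scal Z c T x) \<le> norm c * op_norm X Y T * vnorm X x" if x: "x \<in> vecs X" for x
        using D(2)[OF x] linear_opsD(1)[OF D(1) x] mult_left_mono[of _ _ "norm c"]
        by (auto simp: scal Y.vnorm_scal mult.assoc)
    qed
    show "vnorm Z (scal Z c T) = norm c * vnorm Z T" if T: "T \<in> vecs Z" for c T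
    proof (cases "c = 0")
      case True
      have "scal Z 0 T = 0" by simp
      moreover have "unit_ball X \<noteq> {}" using X.zero_unit_ball by blast
      then have "op_norm X Y 0 = 0" by (simp add: op_norm_def)
      ultimately show ?thesis using True by (simp add: vnorm)
    next
      case False
      \<comment> \<open>The reverse inequality is \<open>le\<close> for the scalar
        \<open>inverse c\<close> and the operator \<open>scal Z c T\<close>.\<close>
      have "vnorm Z (scal Z (inverse c) (scal Z c T)) \<le> norm (inverse c) * vnorm Z (scal Z c T)"
        by (intro le) (simp add: scal scl T)
      then have "norm c * vnorm Z T \<le> vnorm Z (scal Z c T)"
        using False by (simp add: norm_divide field_simps)
      then show ?thesis using le[OF T, of c] by simp
    qed
  qed
qed

lemma normed_bounded_ops: "normed_nspace (bounded_ops X Y)"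
proof (rule normed_operators)
  show "0 \<in> vecs (bounded_ops X Y)"
    by (rule bounded_opsI[where C = 0]) (auto simp: linear_ops_subspace)
  show "S + T \<in> vecs (bounded_ops X Y)" if "S \<in> vecs (bounded_ops X Y)" "T \<in> vecs (bounded_ops X Y)" for S T
  proof (rule bounded_opsI[where C = "op_norm X Y S + op_norm X Y T"])
    note D = bounded_opsD[OF that(1)] bounded_opsD[OF that(2)]
    show "S + T \<in> linear_ops X Y" using D by (intro linear_ops_subspace)
    show "vnorm Y ((S + T) x) \<le> (op_norm X Y S + op_norm X Y T) * vnorm X x" if x: "x \<in> vecs X" for x
      using D(2,5)[OF x] Y.vnorm_triangle[of "S x" "T x"] linear_opsD(1)[OF D(1) x] linear_opsD(1)[OF D(4) x]
      by (simp add: algebra_simps)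
  qed
  show "(\<lambda>x. scal Y c (T x)) \<in> vecs (bounded_ops X Y)" if "T \<in> vecs (bounded_ops X Y)" for c T
  proof (rule bounded_opsI[where C = "norm c * op_norm X Y T"])
    note D = bounded_opsD[OF that]
    show "(\<lambda>x. scal Y c (T x)) \<in> linear_ops X Y" using D by (intro linear_ops_subspace)
    show "vnorm Y (scal Y c (T x)) \<le> norm c * op_norm X Y T * vnorm X x" if x: "x \<in> vecs X" for x
      using D(2)[OF x] linear_opsD(1)[OF D(1) x] mult_left_mono[of _ _ "norm c"]
      by (auto simp: Y.vnorm_scal mult.assoc)
  qed
qed (auto simp: bounded_ops_def)

end

text \<open>The metric axioms are assumed separately: \<open>norm_topology\<close> uses
  \<open>vnorm Y (x - y)\<close> without truncation, while \<open>normed_nspace\<close> controls the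
  norm on the carrier only.\<close>

locale operator_pair = normed_pair X Y + YM: Metric_space "vecs Y" "\<lambda>x y. vnorm Y (x - y)"
  for X :: "('k::{real_normed_field, euclidean_space}, 'v::ab_group_add) nspace"
    and Y :: "('k, 'w::ab_group_add) nspace" +
  assumes complete: "Y.complete_nspace"
begin

lemma MCauchy_iff: "YM.MCauchy u \<longleftrightarrow> range u \<subseteq> vecs Y \<and> Y.cauchy u"
  by (simp add: YM.MCauchy_def Y.cauchy_def)

lemma mcomplete: "YM.mcomplete"
  unfolding YM.mcomplete_def MCauchy_iff
proof (intro allI impI, elim conjE)
  fix u assume u: "range u \<subseteq> vecs Y" "Y.cauchy u"
  then obtain a where "a \<in> vecs Y" "Y.converges u a"
    using complete unfolding Y.complete_nspace_def by blast
  then show "\<exists>a. limitin YM.mtopology u a sequentially"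
    using u(1) by (auto simp: YM.limitin_metric_dist_null Y.converges_def image_subset_iff)
qed

text \<open>Completeness of \<open>Y\<close> turns compactness of the closure into total
  boundedness, a condition that passes to uniform limits.\<close>

lemma compact_ops_iff_mtotally_bounded:
  "T \<in> vecs (compact_ops X Y) \<longleftrightarrow> T \<in> linear_ops X Y \<and> YM.mtotally_bounded (T ` unit_ball X)"
  using linear_ops_vecs[of T]
  by (auto simp: compact_ops_def norm_topology_def YM.mtotally_bounded_eq_compact_closure_of[OF mcomplete])

text \<open>This criterion mentions no limit points, so closure under sums only takes two successive
  extractions of subsequences.\<close>

lemma compact_ops_iff_subsequence:
  "T \<in> vecs (compact_ops X Y) \<longleftrightarrow> T \<in> linear_ops X Y \<and>
    (\<forall>u. range u \<subseteq> unit_ball X \<longrightarrow> (\<exists>r::nat \<Rightarrow> nat. strict_mono r \<and> Y.cauchy (\<lambda>n. T (u (r n)))))"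
proof (cases "T \<in> linear_ops X Y")
  case True
  note [simp] = linear_ops_vecs[OF True]
  have "YM.mtotally_bounded (T ` unit_ball X) \<longleftrightarrow>
    (\<forall>v. range v \<subseteq> T ` unit_ball X \<longrightarrow> (\<exists>r::nat \<Rightarrow> nat. strict_mono r \<and> YM.MCauchy (v \<circ> r)))"
    unfolding YM.mtotally_bounded_sequentially by auto
  also have "\<dots> \<longleftrightarrow> (\<forall>u. range u \<subseteq> unit_ball X \<longrightarrow>
      (\<exists>r::nat \<Rightarrow> nat. strict_mono r \<and> Y.cauchy (\<lambda>n. T (u (r n)))))" (is "?L \<longleftrightarrow> ?R")
  proof
    assume ?L
    show ?R
    proof (intro allI impI)
      fix u :: "nat \<Rightarrow> 'v" assume "range u \<subseteq> unit_ball X"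
      then have "range (T \<circ> u) \<subseteq> T ` unit_ball X" by auto
      then obtain r :: "nat \<Rightarrow> nat" where "strict_mono r" "YM.MCauchy ((T \<circ> u) \<circ> r)"
        using \<open>?L\<close> by blast
      then show "\<exists>r::nat \<Rightarrow> nat. strict_mono r \<and> Y.cauchy (\<lambda>n. T (u (r n)))"
        by (auto simp: MCauchy_iff o_def)
    qed
  next
    assume ?R
    show ?L
    proof (intro allI impI)
      fix v :: "nat \<Rightarrow> 'w" assume "range v \<subseteq> T ` unit_ball X"
      then have "\<forall>n. \<exists>x. x \<in> unit_ball X \<and> v n = T x" by (auto simp: image_subset_iff)
      then obtain u where u: "\<And>n. u n \<in> unit_ball X" "\<And>n. v n = T (u n)" by metis
      then have "range u \<subseteq> unit_ball X" by auto
      then obtain r :: "nat \<Rightarrow> nat" where "strict_mono r" "Y.cauchy (\<lambda>n. T (u (r n)))"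
        using \<open>?R\<close> by blast
      then show "\<exists>r::nat \<Rightarrow> nat. strict_mono r \<and> YM.MCauchy (v \<circ> r)"
        by (intro exI[of _ r]) (auto simp: MCauchy_iff o_def u(2))
    qed
  qed
  finally show ?thesis by (simp add: compact_ops_iff_mtotally_bounded True)
qed (simp add: compact_ops_iff_mtotally_bounded)

lemma compact_ops_bounded: "vecs (compact_ops X Y) \<subseteq> vecs (bounded_ops X Y)"
proof
  fix T assume "T \<in> vecs (compact_ops X Y)"
  then have T: "T \<in> linear_ops X Y" and "YM.mtotally_bounded (T ` unit_ball X)"
    by (auto simp: compact_ops_iff_mtotally_bounded)
  then have "YM.mbounded (T ` unit_ball X)" by (intro YM.mtotally_bounded_imp_mbounded)
  then obtain y B where yB: "T ` unit_ball X \<subseteq> YM.mcball y B" by (auto simp: YM.mbounded_def)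
  have "vnorm Y (T x) \<le> B + vnorm Y y" if "x \<in> unit_ball X" for x
  proof -
    have "y \<in> vecs Y" "vnorm Y (y - T x) \<le> B" using yB that by auto
    then show ?thesis
      using Y.vnorm_triangle_diff[of y "y - T x"] linear_ops_vecs[OF T, of x] by simp
  qed
  then show "T \<in> vecs (bounded_ops X Y)"
    by (intro bounded_opsI[OF T] bounded_on_ball[OF T])
qed

lemma normed_compact_ops: "normed_nspace (compact_ops X Y)"
proof (rule normed_operators)
  show "0 \<in> vecs (compact_ops X Y)"
    unfolding compact_ops_iff_subsequence
    by (auto simp: linear_ops_subspace Y.cauchy_def intro!: exI[of _ id] strict_mono_id)
  show "S + T \<in> vecs (compact_ops X Y)" if S: "S \<in> vecs (compact_ops X Y)" and T: "T \<in> vecs (compact_ops X Y)" for S T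
    unfolding compact_ops_iff_subsequence
  proof (intro conjI allI impI)
    have lin: "S \<in> linear_ops X Y" "T \<in> linear_ops X Y" using S T by (auto simp: compact_ops_iff_subsequence)
    then show "S + T \<in> linear_ops X Y" by (rule linear_ops_subspace)
    fix u :: "nat \<Rightarrow> 'v" assume u: "range u \<subseteq> unit_ball X"
    then obtain r :: "nat \<Rightarrow> nat" where r: "strict_mono r" "Y.cauchy (\<lambda>n. S (u (r n)))"
      using S unfolding compact_ops_iff_subsequence by blast
    have "range (u \<circ> r) \<subseteq> unit_ball X" using u by auto
    then obtain q :: "nat \<Rightarrow> nat" where q: "strict_mono q" "Y.cauchy (\<lambda>n. T (u (r (q n))))"
      using T unfolding compact_ops_iff_subsequence by fastforce
    have "Y.cauchy (\<lambda>n. (S + T) (u ((r \<circ> q) n)))"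
      unfolding Y.cauchy_def
    proof (intro allI impI)
      fix e :: real assume "0 < e"
      then have "0 < e/2" by simp
      then obtain M N where M: "\<And>m n. m \<ge> M \<Longrightarrow> n \<ge> M \<Longrightarrow> vnorm Y (S (u (r m)) - S (u (r n))) < e/2"
        and N: "\<And>m n. m \<ge> N \<Longrightarrow> n \<ge> N \<Longrightarrow> vnorm Y (T (u (r (q m))) - T (u (r (q n)))) < e/2"
        using r(2) q(2) unfolding Y.cauchy_def by metis
      have "vnorm Y ((S + T) (u ((r \<circ> q) m)) - (S + T) (u ((r \<circ> q) n))) < e"
        if mn: "m \<ge> max M N" "n \<ge> max M N" for m n
      proof -
        \<comment> \<open>Passing to the further subsequence \<open>q\<close> only increases
          indices, so the Cauchy estimate for \<open>S\<close> along \<open>r\<close>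
          persists.\<close>
        have "m \<le> q m" "n \<le> q n" using q(1) by (auto intro: strict_mono_imp_increasing)
        then have "vnorm Y (S (u (r (q m))) - S (u (r (q n)))) < e/2" using mn by (intro M) auto
        moreover have "vnorm Y (T (u (r (q m))) - T (u (r (q n)))) < e/2" using mn by (intro N) auto
        ultimately show ?thesis
          using Y.vnorm_triangle[of "S (u (r (q m))) - S (u (r (q n)))" "T (u (r (q m))) - T (u (r (q n)))"]
            lin[THEN linear_ops_vecs] by (simp add: algebra_simps)
      qed
      then show "\<exists>N. \<forall>m\<ge>N. \<forall>n\<ge>N. vnorm Y ((S + T) (u ((r \<circ> q) m)) - (S + T) (u ((r \<circ> q) n))) < e"
        by blast
    qed
    then show "\<exists>r::nat \<Rightarrow> nat. strict_mono r \<and> Y.cauchy (\<lambda>n. (S + T) (u (r n)))"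
      using strict_mono_o[OF r(1) q(1)] by blast
  qed
  show "(\<lambda>x. scal Y c (T x)) \<in> vecs (compact_ops X Y)" if T: "T \<in> vecs (compact_ops X Y)" for c T
    unfolding compact_ops_iff_subsequence
  proof (intro conjI allI impI)
    have lin: "T \<in> linear_ops X Y" using T by (auto simp: compact_ops_iff_subsequence)
    then show "(\<lambda>x. scal Y c (T x)) \<in> linear_ops X Y" by (rule linear_ops_subspace)
    fix u :: "nat \<Rightarrow> 'v" assume u: "range u \<subseteq> unit_ball X"
    then obtain r :: "nat \<Rightarrow> nat" where r: "strict_mono r" "Y.cauchy (\<lambda>n. T (u (r n)))"
      using T unfolding compact_ops_iff_subsequence by blast
    have "Y.cauchy (\<lambda>n. scal Y c (T (u (r n))))"
      unfolding Y.cauchy_def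
    proof (intro allI impI)
      fix e :: real assume e: "0 < e"
      have "0 < norm c + 1" by (smt (verit) norm_ge_zero)
      then have "0 < e / (norm c + 1)" using e by simp
      then obtain N where N: "\<And>m n. m \<ge> N \<Longrightarrow> n \<ge> N \<Longrightarrow> vnorm Y (T (u (r m)) - T (u (r n))) < e / (norm c + 1)"
        using r(2) unfolding Y.cauchy_def by metis
      have "vnorm Y (scal Y c (T (u (r m))) - scal Y c (T (u (r n)))) < e" if mn: "m \<ge> N" "n \<ge> N" for m n
      proof -
        have v: "T (u (r m)) - T (u (r n)) \<in> vecs Y" using linear_ops_vecs[OF lin] by simp
        have "vnorm Y (scal Y c (T (u (r m))) - scal Y c (T (u (r n)))) = norm c * vnorm Y (T (u (r m)) - T (u (r n)))"
          using v by (simp add: Y.vnorm_scal flip: Y.scale_right_diff_distrib)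
        also have "\<dots> \<le> (norm c + 1) * vnorm Y (T (u (r m)) - T (u (r n)))"
          using v Y.vnorm_nonneg by (intro mult_right_mono) auto
        also have "\<dots> < e" using N[OF mn] \<open>0 < norm c + 1\<close> by (simp add: field_simps)
        finally show ?thesis .
      qed
      then show "\<exists>N. \<forall>m\<ge>N. \<forall>n\<ge>N. vnorm Y (scal Y c (T (u (r m))) - scal Y c (T (u (r n)))) < e" by blast
    qed
    then show "\<exists>r::nat \<Rightarrow> nat. strict_mono r \<and> Y.cauchy (\<lambda>n. scal Y c (T (u (r n))))" using r by blast
  qed
qed (use compact_ops_bounded in \<open>auto simp: compact_ops_def\<close>)

sublocale E: normed_nspace "compact_ops X Y"
  by (rule normed_compact_ops)

lemma compact_opsD:
  assumes "T \<in> vecs (compact_ops X Y)"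
  shows "T \<in> linear_ops X Y"
    and "x \<in> vecs X \<Longrightarrow> vnorm Y (T x) \<le> vnorm (compact_ops X Y) T * vnorm X x"
    and "T x \<in> vecs Y"
  using assms compact_ops_bounded bounded_opsD[of T] linear_ops_vecs[of T]
  by (auto simp: compact_ops_def[of X Y])

text \<open>The pointwise limit exists by completeness of \<open>Y\<close> and is linear. The Cauchy
  condition makes the convergence uniform on the unit ball, so a finite net for the image under some
  \<open>u n\<close> yields one for the image under the limit.\<close>

lemma complete_compact_ops: "E.complete_nspace"
  unfolding E.complete_nspace_def
proof (intro allI impI)
  fix u assume u: "range u \<subseteq> vecs (compact_ops X Y)" and cauchy: "E.cauchy u"
  have uE: "u n \<in> vecs (compact_ops X Y)" for n using u by auto
  have D: "vnorm Y (u m x - u n x) \<le> vnorm (compact_ops X Y) (u m - u n) * vnorm X x" if "x \<in> vecs X" for m n x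
    using compact_opsD(2)[OF _ that, of "u m - u n"] uE by simp
  have uY: "u n x \<in> vecs Y" for n x using compact_opsD(3)[OF uE] .
  have "\<exists>y\<in>vecs Y. Y.converges (\<lambda>n. u n x) y" if x: "x \<in> vecs X" for x
  proof -
    have "Y.cauchy (\<lambda>n. u n x)"
      unfolding Y.cauchy_def
    proof (intro allI impI)
      fix e :: real assume e: "0 < e"
      have pos: "0 < vnorm X x + 1" using X.vnorm_nonneg[OF x] by linarith
      then have "0 < e / (vnorm X x + 1)" using e by simp
      then obtain N where N: "\<And>m n. m \<ge> N \<Longrightarrow> n \<ge> N \<Longrightarrow> vnorm (compact_ops X Y) (u m - u n) < e / (vnorm X x + 1)"
        using cauchy unfolding E.cauchy_def by metis
      have "vnorm Y (u m x - u n x) < e" if mn: "m \<ge> N" "n \<ge> N" for m n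
      proof -
        have "vnorm Y (u m x - u n x) \<le> vnorm (compact_ops X Y) (u m - u n) * vnorm X x" by (rule D[OF x])
        also have "\<dots> \<le> vnorm (compact_ops X Y) (u m - u n) * (vnorm X x + 1)"
          using uE by (intro mult_left_mono E.vnorm_nonneg) auto
        also have "\<dots> < e" using N[OF mn] pos by (simp add: field_simps)
        finally show ?thesis .
      qed
      then show "\<exists>N. \<forall>m\<ge>N. \<forall>n\<ge>N. vnorm Y (u m x - u n x) < e" by blast
    qed
    moreover have "range (\<lambda>n. u n x) \<subseteq> vecs Y" using uY by auto
    ultimately show ?thesis using complete by (simp add: Y.complete_nspace_def)
  qed
  then obtain L where L: "\<And>x. x \<in> vecs X \<Longrightarrow> L x \<in> vecs Y" "\<And>x. x \<in> vecs X \<Longrightarrow> Y.converges (\<lambda>n. u n x) (L x)"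
    by metis
  \<comment> \<open>\<open>L\<close> is arbitrary off the carrier, where an operator has to be
    0.\<close>
  define T where "T = (\<lambda>x. if x \<in> vecs X then L x else 0)"
  have T: "T x \<in> vecs Y" "Y.converges (\<lambda>n. u n x) (T x)" if "x \<in> vecs X" for x
    using L that by (auto simp: T_def)
  have lin: "T \<in> linear_ops X Y"
    unfolding linear_ops_def
  proof (intro CollectI conjI ballI allI impI)
    show "T x \<in> vecs Y" if "x \<in> vecs X" for x using T that by blast
    show "T x = 0" if "x \<notin> vecs X" for x using that by (simp add: T_def)
    note ulin = linear_opsD[OF compact_opsD(1)[OF uE]]
    show "T (x + y) = T x + T y" if "x \<in> vecs X" "y \<in> vecs X" for x y
    proof (rule Y.converges_unique[where u = "\<lambda>n. u n (x + y)"])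
      have "Y.converges (\<lambda>n. u n x + u n y) (T x + T y)"
        using T that uY by (intro Y.converges_add) auto
      then show "Y.converges (\<lambda>n. u n (x + y)) (T x + T y)" using ulin(2) that by simp
    qed (use T that uY in auto)
    show "T (scal X c x) = scal Y c (T x)" if "x \<in> vecs X" for c x
    proof (rule Y.converges_unique[where u = "\<lambda>n. u n (scal X c x)"])
      have "Y.converges (\<lambda>n. scal Y c (u n x)) (scal Y c (T x))"
        using T that uY by (intro Y.converges_scal) auto
      then show "Y.converges (\<lambda>n. u n (scal X c x)) (scal Y c (T x))" using ulin(3) that by simp
    qed (use T that uY in auto)
  qed
  have close: "\<exists>N. \<forall>n\<ge>N. \<forall>x\<in>vecs X. vnorm Y (u n x - T x) \<le> e * vnorm X x" if e: "0 < e" for e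
  proof -
    obtain N where N: "\<And>m n. m \<ge> N \<Longrightarrow> n \<ge> N \<Longrightarrow> vnorm (compact_ops X Y) (u m - u n) < e"
      using cauchy e unfolding E.cauchy_def by metis
    \<comment> \<open>Pass through \<open>u m x\<close> and let \<open>m\<close> tend to infinity
      with \<open>n\<close> and \<open>x\<close> fixed.\<close>
    have "vnorm Y (u n x - T x) \<le> e * vnorm X x" if n: "n \<ge> N" and x: "x \<in> vecs X" for n x
    proof (rule LIMSEQ_le_const)
      show "(\<lambda>m. e * vnorm X x + vnorm Y (u m x - T x)) \<longlonglongrightarrow> e * vnorm X x"
        using tendsto_add[OF tendsto_const T(2)[OF x, unfolded Y.converges_def]] by simp
      have "vnorm Y (u n x - T x) \<le> e * vnorm X x + vnorm Y (u m x - T x)" if m: "m \<ge> N" for m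
      proof -
        have "vnorm Y (u n x - u m x) \<le> vnorm (compact_ops X Y) (u n - u m) * vnorm X x" by (rule D[OF x])
        also have "\<dots> \<le> e * vnorm X x"
          using N[OF n m] X.vnorm_nonneg[OF x] by (intro mult_right_mono) auto
        finally show ?thesis using Y.vnorm_triangle_via[of "u n x" "u m x" "T x"] uY T(1)[OF x] by simp
      qed
      then show "\<exists>N. \<forall>m\<ge>N. vnorm Y (u n x - T x) \<le> e * vnorm X x + vnorm Y (u m x - T x)" by blast
    qed
    then show ?thesis by blast
  qed
  have "YM.mtotally_bounded (T ` unit_ball X)"
    unfolding YM.mtotally_bounded_def
  proof (intro allI impI)
    fix e :: real assume e: "0 < e"
    then obtain n where n: "\<And>x. x \<in> vecs X \<Longrightarrow> vnorm Y (u n x - T x) \<le> e/4 * vnorm X x"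
      using close[of "e/4"] by auto
    have n': "vnorm Y (u n x - T x) \<le> e/4" if "x \<in> unit_ball X" for x
    proof -
      have "e/4 * vnorm X x \<le> e/4 * 1" using that e by (intro mult_left_mono) (auto simp: unit_ball_def)
      then show ?thesis using n[of x] that by (auto simp: unit_ball_def)
    qed
    have "YM.mtotally_bounded (u n ` unit_ball X)" using uE by (simp add: compact_ops_iff_mtotally_bounded)
    then obtain K where "finite K" "K \<subseteq> u n ` unit_ball X" and K: "u n ` unit_ball X \<subseteq> (\<Union>y\<in>K. YM.mball y (e/4))"
      using e unfolding YM.mtotally_bounded_def by (meson divide_pos_pos zero_less_numeral)
    then obtain F where F: "F \<subseteq> unit_ball X" "finite F" "K = u n ` F" by (meson finite_subset_image)
    \<comment> \<open>Replacing \<open>u n\<close> by \<open>T\<close> costs \<open>e/4\<close> at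
      the net point and \<open>e/4\<close> at \<open>x\<close>; with the net radius
      \<open>e/4\<close> the total stays below \<open>e\<close>.\<close>
    have "T ` unit_ball X \<subseteq> (\<Union>y\<in>T ` F. YM.mball y e)"
    proof (clarify)
      fix x assume x: "x \<in> unit_ball X"
      then have "u n x \<in> (\<Union>y\<in>K. YM.mball y (e/4))" using K by blast
      then obtain z where z: "z \<in> F" "vnorm Y (u n z - u n x) < e/4" using F(3) by auto
      have TY: "T x \<in> vecs Y" "T z \<in> vecs Y" using lin by (auto intro: linear_ops_vecs)
      have "vnorm Y (T z - T x) \<le> vnorm Y (T z - u n z) + (vnorm Y (u n z - u n x) + vnorm Y (u n x - T x))"
        using Y.vnorm_triangle_via[of "T z" "u n z" "T x"] Y.vnorm_triangle_via[of "u n z" "u n x" "T x"] uY TY by auto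
      also have "\<dots> < e"
        using n'[OF x] n'[of z] z F(1) e Y.vnorm_diff_commute[OF TY(2) uY[of n z]] by (simp add: subset_iff)
      finally show "T x \<in> (\<Union>y\<in>T ` F. YM.mball y e)" using z TY by auto
    qed
    then show "\<exists>K. finite K \<and> K \<subseteq> T ` unit_ball X \<and> T ` unit_ball X \<subseteq> (\<Union>x\<in>K. YM.mball x e)"
      using F by (intro exI[of _ "T ` F"]) auto
  qed
  then have TE: "T \<in> vecs (compact_ops X Y)" using lin by (simp add: compact_ops_iff_mtotally_bounded)
  have "E.converges u T"
    unfolding E.converges_def
  proof (rule LIMSEQ_I)
    fix e :: real assume e: "0 < e"
    then obtain N where N: "\<And>n x. n \<ge> N \<Longrightarrow> x \<in> vecs X \<Longrightarrow> vnorm Y (u n x - T x) \<le> e/2 * vnorm X x"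
      using close[of "e/2"] by auto
    have "norm (vnorm (compact_ops X Y) (u n - T) - 0) < e" if n: "n \<ge> N" for n
    proof -
      have "op_norm X Y (u n - T) \<le> e/2" using N[OF n] e by (intro op_norm_le) auto
      moreover have "0 \<le> vnorm (compact_ops X Y) (u n - T)" using uE TE by (intro E.vnorm_nonneg) auto
      ultimately show ?thesis using e by (simp add: compact_ops_def)
    qed
    then show "\<exists>N. \<forall>n\<ge>N. norm (vnorm (compact_ops X Y) (u n - T) - 0) < e" by blast
  qed
  then show "\<exists>T\<in>vecs (compact_ops X Y). E.converges u T" using TE by blast
qed

text \<open>The scalars \<open>f (u n)\<close> are bounded and the scalar field is
  finite-dimensional, so some subsequence of them converges; multiplication with the fixed vector
  \<open>y\<close> preserves this.\<close>

lemma rank_one_compact: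
  assumes f: "f \<in> vecs (dual X)" and y: "y \<in> vecs Y"
  shows "(\<lambda>x. scal Y (f x) y) \<in> vecs (compact_ops X Y)"
  unfolding compact_ops_iff_subsequence
proof (intro conjI allI impI)
  show "(\<lambda>x. scal Y (f x) y) \<in> linear_ops X Y"
    using f y by (auto simp: linear_ops_def dual_def bounded_ops_def scalar_space_def Y.scale_left_distrib)
  fix u :: "nat \<Rightarrow> 'v" assume u: "range u \<subseteq> unit_ball X"
  obtain C where C: "\<And>x. x \<in> vecs X \<Longrightarrow> norm (f x) \<le> C * vnorm X x"
    using f by (auto simp: dual_def bounded_ops_def scalar_space_def)
  have "norm (f (u n)) \<le> \<bar>C\<bar>" for n
  proof -
    have un: "u n \<in> vecs X" "vnorm X (u n) \<le> 1" using u by (auto simp: unit_ball_def image_subset_iff)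
    have "norm (f (u n)) \<le> C * vnorm X (u n)" using C un by blast
    also have "\<dots> \<le> \<bar>C\<bar> * 1" using un by (intro mult_mono) auto
    finally show ?thesis by simp
  qed
  then have "\<forall>n. f (u n) \<in> cball 0 \<bar>C\<bar>" by simp
  then obtain l and r :: "nat \<Rightarrow> nat" where r: "strict_mono r" "((\<lambda>n. f (u n)) \<circ> r) \<longlonglongrightarrow> l"
    using compact_cball[of "0::'k" "\<bar>C\<bar>"] unfolding compact_eq_seq_compact_metric seq_compact_def by metis
  have "Y.converges (\<lambda>n. scal Y (f (u (r n))) y) (scal Y l y)"
  proof -
    have "(\<lambda>n. norm (f (u (r n)) - l) * vnorm Y y) \<longlonglongrightarrow> 0"
      using r(2) by (auto simp: o_def LIM_zero_iff intro!: tendsto_mult_left_zero tendsto_norm_zero)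
    then show ?thesis
      using y by (simp add: Y.converges_def Y.vnorm_scal flip: Y.scale_left_diff_distrib)
  qed
  then have "Y.cauchy (\<lambda>n. scal Y (f (u (r n))) y)"
    using y by (intro Y.converges_imp_cauchy) auto
  then show "\<exists>r::nat \<Rightarrow> nat. strict_mono r \<and> Y.cauchy (\<lambda>n. scal Y (f (u (r n))) y)"
    using r by blast
qed

end

section \<open>Functionals and the dual norm\<close>

context normed_nspace
begin

lemma normed_pair_scalar: "normed_pair X scalar_space"
  by (simp add: normed_pair_def normed_nspace_axioms normed_nspace_scalar)

lemma normed_dual: "normed_nspace (dual X)"
  unfolding dual_def by (rule normed_pair.normed_bounded_ops[OF normed_pair_scalar])

lemma dualD:
  assumes "y \<in> vecs (dual X)"
  shows "u \<in> vecs X \<Longrightarrow> v \<in> vecs X \<Longrightarrow> y (u + v) = y u + y v"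
    and "u \<in> vecs X \<Longrightarrow> y (scal X c u) = c * y u"
    and "u \<in> vecs X \<Longrightarrow> norm (y u) \<le> vnorm (dual X) y * vnorm X u"
    and "(\<And>i. i \<in> A \<Longrightarrow> f i \<in> vecs X) \<Longrightarrow> y (sum f A) = (\<Sum>i\<in>A. y (f i))"
proof -
  interpret P: normed_pair X "scalar_space :: ('k, 'k) nspace" by (rule normed_pair_scalar)
  note y = assms[unfolded dual_def]
  have vn: "vnorm (dual X) = op_norm X scalar_space" by (simp add: dual_def bounded_ops_def)
  show "u \<in> vecs X \<Longrightarrow> v \<in> vecs X \<Longrightarrow> y (u + v) = y u + y v"
    by (rule P.linear_opsD[OF P.bounded_opsD(1)[OF y]])
  show "u \<in> vecs X \<Longrightarrow> y (scal X c u) = c * y u"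
    using P.linear_opsD(3)[OF P.bounded_opsD(1)[OF y]] by (simp add: scalar_space_def)
  show "u \<in> vecs X \<Longrightarrow> norm (y u) \<le> vnorm (dual X) y * vnorm X u"
    using P.bounded_opsD(2)[OF y, of u] unfolding vn by (simp add: scalar_space_def)
  show "(\<And>i. i \<in> A \<Longrightarrow> f i \<in> vecs X) \<Longrightarrow> y (sum f A) = (\<Sum>i\<in>A. y (f i))"
    by (rule P.linear_ops_sum[OF P.bounded_opsD(1)[OF y]])
qed

lemma dualI:
  assumes "\<And>u. u \<in> vecs X \<Longrightarrow> norm (y u) \<le> C * vnorm X u" and "0 \<le> C"
    and "\<And>u v. u \<in> vecs X \<Longrightarrow> v \<in> vecs X \<Longrightarrow> y (u + v) = y u + y v"
    and "\<And>c u. u \<in> vecs X \<Longrightarrow> y (scal X c u) = c * y u"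
    and "\<And>u. u \<notin> vecs X \<Longrightarrow> y u = 0"
  shows "y \<in> vecs (dual X)" and "vnorm (dual X) y \<le> C"
proof -
  interpret P: normed_pair X "scalar_space :: ('k, 'k) nspace" by (rule normed_pair_scalar)
  have "y \<in> linear_ops X scalar_space" using assms by (auto simp: linear_ops_def scalar_space_def)
  then show "y \<in> vecs (dual X)"
    unfolding dual_def using assms(1) by (intro P.bounded_opsI) (auto simp: scalar_space_def)
  have "op_norm X scalar_space y \<le> C" using assms by (intro P.op_norm_le) (auto simp: scalar_space_def)
  then show "vnorm (dual X) y \<le> C" by (simp add: dual_def bounded_ops_def)
qed

end

section \<open>Sequence spaces\<close>

text \<open>For positive arguments this is \<open>powr_convex\<close>; if one argument is 0, it
  reduces to \<open>s powr p <= s\<close> for \<open>0 <= s <= 1\<close>.\<close>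

lemma powr_convex_nonneg:
  fixes u v :: real
  assumes "p \<ge> 1" "0 \<le> t" "t \<le> 1" "0 \<le> u" "0 \<le> v"
  shows "(t * u + (1 - t) * v) powr p \<le> t * u powr p + (1 - t) * v powr p"
proof -
  have shrink: "(s * w) powr p \<le> s * w powr p" if "0 \<le> s" "s \<le> 1" "0 \<le> w" for s w :: real
  proof (cases "s = 0")
    case False
    then have "s powr p \<le> s powr 1" using that assms(1) by (intro powr_mono') auto
    then have "s powr p * w powr p \<le> s * w powr p" using that False by (intro mult_right_mono) auto
    then show ?thesis using that by (simp add: powr_mult)
  qed simp
  consider "u = 0" | "v = 0" | "0 < u" "0 < v" using assms by linarith
  then show ?thesis
  proof cases
    case 3
    have "((1 - (1 - t)) *\<^sub>R u + (1 - t) *\<^sub>R v) powr p \<le> (1 - (1 - t)) * u powr p + (1 - t) * v powr p"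
      using assms 3 by (intro convex_onD[OF powr_convex]) auto
    then show ?thesis by simp
  qed (use assms shrink[of t u] shrink[of "1 - t" v] in auto)
qed

context
  fixes p :: real
  assumes p: "1 \<le> p"
begin

lemma scal_lspace: "scal (lspace p) c x = (\<lambda>n. c * x n)"
  by (simp add: lspace_def)

lemma vnorm_lspace_nonneg: "0 \<le> vnorm (lspace p) x"
  by (simp add: lspace_def)

lemma suminf_norm_powr:
  "x \<in> vecs (lspace p) \<Longrightarrow> (\<Sum>n. norm (x n) powr p) = vnorm (lspace p) x powr p"
  using p by (simp add: lspace_def powr_powr suminf_nonneg)

lemma sum_norm_powr_le:
  assumes "x \<in> vecs (lspace p)"
  shows "(\<Sum>i<m. norm (x i) powr p) \<le> vnorm (lspace p) x powr p"
  unfolding suminf_norm_powr[OF assms, symmetric]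
  using assms by (intro sum_le_suminf) (auto simp: lspace_def)

lemma sum_norm_le_vnorm:
  assumes "x \<in> vecs (lspace p)"
  shows "(\<Sum>i<m. norm (x i) powr p) powr (1/p) \<le> vnorm (lspace p) x"
proof -
  have "(\<Sum>i<m. norm (x i) powr p) powr (1/p) \<le> (vnorm (lspace p) x powr p) powr (1/p)"
    using p sum_norm_powr_le[OF assms] by (intro powr_mono2) (auto simp: sum_nonneg)
  then show ?thesis using p vnorm_lspace_nonneg[of x] by (simp add: powr_powr)
qed

lemma norm_coord_le:
  assumes "x \<in> vecs (lspace p)"
  shows "norm (x i) \<le> vnorm (lspace p) x"
proof -
  have "norm (x i) powr p \<le> (\<Sum>j<Suc i. norm (x j) powr p)" by (intro member_le_sum) auto
  also have "\<dots> \<le> vnorm (lspace p) x powr p" by (rule sum_norm_powr_le[OF assms])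
  finally show ?thesis using p vnorm_lspace_nonneg
    by (metis norm_ge_zero not_le powr_less_mono2 less_le_trans zero_less_one)
qed

lemma lspaceI:
  assumes "0 \<le> C" "\<And>m. (\<Sum>i<m. norm (x i) powr p) \<le> C powr p"
  shows "x \<in> vecs (lspace p)" and "vnorm (lspace p) x \<le> C"
proof -
  have s: "summable (\<lambda>n. norm (x n) powr p)" using assms(2) by (intro summableI_nonneg_bounded) auto
  then show "x \<in> vecs (lspace p)" by (simp add: lspace_def)
  have "(\<Sum>n. norm (x n) powr p) powr (1/p) \<le> (C powr p) powr (1/p)"
    using p s assms(2) by (intro powr_mono2 suminf_le_const) (auto simp: suminf_nonneg)
  then show "vnorm (lspace p) x \<le> C" using p assms(1) by (simp add: lspace_def powr_powr)
qed

lemma vnorm_finite_support: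
  assumes "\<And>i. i \<ge> m \<Longrightarrow> x i = 0"
  shows "x \<in> vecs (lspace p)" and "vnorm (lspace p) x = (\<Sum>i<m. norm (x i) powr p) powr (1/p)"
proof -
  have 0: "norm (x i) powr p = 0" if "i \<notin> {..<m}" for i using assms[of i] that by simp
  show "x \<in> vecs (lspace p)"
    using summable_finite[of "{..<m}" "\<lambda>i. norm (x i) powr p"] 0 by (simp add: lspace_def)
  show "vnorm (lspace p) x = (\<Sum>i<m. norm (x i) powr p) powr (1/p)"
    using suminf_finite[of "{..<m}" "\<lambda>i. norm (x i) powr p"] 0 by (simp add: lspace_def)
qed

text \<open>After scaling, \<open>x / a\<close> and \<open>y / b\<close> lie in the unit ball, and
  \<open>(x + y) / (a + b)\<close> is their convex combination with weights \<open>t\<close> and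
  \<open>1 - t\<close>. Upper bounds \<open>a\<close> and \<open>b\<close> replace the norms to keep
  the denominators positive; they approach the norms at the end.\<close>

lemma minkowski:
  assumes x: "x \<in> vecs (lspace p)" and y: "y \<in> vecs (lspace p)"
  shows "x + y \<in> vecs (lspace p)" and "vnorm (lspace p) (x + y) \<le> vnorm (lspace p) x + vnorm (lspace p) y"
proof -
  have *: "(\<Sum>i<m. norm ((x + y) i) powr p) \<le> (a + b) powr p"
    if a: "vnorm (lspace p) x \<le> a" "0 < a" and b: "vnorm (lspace p) y \<le> b" "0 < b" for a b m
  proof -
    define t where "t = a / (a + b)"
    have t: "0 \<le> t" "t \<le> 1" "1 - t = b / (a + b)" using a b by (auto simp: t_def field_simps)
    have 1: "(\<Sum>i<m. (norm (z i) / c) powr p) \<le> 1"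
      if "z \<in> vecs (lspace p)" "vnorm (lspace p) z \<le> c" "0 < c" for z :: "nat \<Rightarrow> 'a" and c
    proof -
      have "(\<Sum>i<m. (norm (z i) / c) powr p) = (\<Sum>i<m. norm (z i) powr p) / c powr p"
        by (simp add: powr_divide sum_divide_distrib)
      also have "\<dots> \<le> vnorm (lspace p) z powr p / c powr p"
        using sum_norm_powr_le[OF that(1)] by (intro divide_right_mono) auto
      also have "\<dots> \<le> c powr p / c powr p"
        using that p vnorm_lspace_nonneg[of z] by (intro divide_right_mono powr_mono2) auto
      finally show ?thesis using that by simp
    qed
    have pw: "norm ((x + y) i) powr p
        \<le> (a + b) powr p * (t * (norm (x i) / a) powr p + (1 - t) * (norm (y i) / b) powr p)" for i
    proof -
      have "norm ((x + y) i) powr p \<le> ((a + b) * (t * (norm (x i) / a) + (1 - t) * (norm (y i) / b))) powr p"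
      proof (intro powr_mono2)
        have "(a + b) * (t * (norm (x i) / a) + (1 - t) * (norm (y i) / b)) = norm (x i) + norm (y i)"
          unfolding t(3) using a b by (simp add: t_def distrib_left)
        then show "norm ((x + y) i) \<le> (a + b) * (t * (norm (x i) / a) + (1 - t) * (norm (y i) / b))"
          by (simp add: norm_triangle_ineq)
      qed (use p in auto)
      also have "\<dots> = (a + b) powr p * (t * (norm (x i) / a) + (1 - t) * (norm (y i) / b)) powr p"
        by (simp add: powr_mult)
      also have "\<dots> \<le> (a + b) powr p * (t * (norm (x i) / a) powr p + (1 - t) * (norm (y i) / b) powr p)"
        using a b t p by (intro mult_left_mono powr_convex_nonneg) auto
      finally show ?thesis .
    qed
    have "(\<Sum>i<m. norm ((x + y) i) powr p)
        \<le> (\<Sum>i<m. (a + b) powr p * (t * (norm (x i) / a) powr p + (1 - t) * (norm (y i) / b) powr p))"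
      by (intro sum_mono pw)
    also have "\<dots> = (a + b) powr p * (t * (\<Sum>i<m. (norm (x i) / a) powr p) + (1 - t) * (\<Sum>i<m. (norm (y i) / b) powr p))"
      by (simp only: sum_distrib_left sum.distrib distrib_left)
    also have "\<dots> \<le> (a + b) powr p * (t * 1 + (1 - t) * 1)"
      using t 1[OF x a] 1[OF y b] by (intro mult_left_mono add_mono) auto
    finally show ?thesis by simp
  qed
  have nn: "0 \<le> vnorm (lspace p) x" "0 \<le> vnorm (lspace p) y" by (rule vnorm_lspace_nonneg)+
  show "x + y \<in> vecs (lspace p)"
    using lspaceI(1)[OF _ *[of "vnorm (lspace p) x + 1" "vnorm (lspace p) y + 1"]] nn by (simp add: plus_fun_def)
  show "vnorm (lspace p) (x + y) \<le> vnorm (lspace p) x + vnorm (lspace p) y"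
  proof (rule field_le_epsilon)
    fix e :: real assume "0 < e"
    then show "vnorm (lspace p) (x + y) \<le> vnorm (lspace p) x + vnorm (lspace p) y + e"
      using lspaceI(2)[OF _ *[of "vnorm (lspace p) x + e/2" "vnorm (lspace p) y + e/2"]] nn by (simp add: plus_fun_def)
  qed
qed

lemma normed_lspace: "normed_nspace (lspace p :: ('k::real_normed_field, nat \<Rightarrow> 'k) nspace)"
proof -
  let ?X = "lspace p :: ('k, nat \<Rightarrow> 'k) nspace"
  interpret module "scal ?X"
    by standard (auto simp: lspace_def fun_eq_iff algebra_simps)
  have norm_scal: "norm (c * x n) powr p = norm c powr p * norm (x n) powr p" for c :: 'k and x :: "nat \<Rightarrow> 'k" and n
    by (simp add: norm_mult powr_mult)
  show ?thesis
  proof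
    show "subspace (vecs ?X)"
    proof (rule subspaceI)
      show "0 \<in> vecs ?X" using p by (simp add: lspace_def)
      show "scal ?X c x \<in> vecs ?X" if "x \<in> vecs ?X" for c x
        using that by (auto simp: lspace_def norm_scal intro!: summable_mult)
    qed (rule minkowski)
    show "x = 0" if "x \<in> vecs ?X" "vnorm ?X x = 0" for x
      using norm_coord_le[OF that(1)] that(2) by (auto simp: fun_eq_iff)
    show "vnorm ?X (scal ?X c x) = norm c * vnorm ?X x" if "x \<in> vecs ?X" for c x
    proof -
      have s: "summable (\<lambda>n. norm (x n) powr p)" using that by (simp add: lspace_def)
      have "vnorm ?X (scal ?X c x) = (norm c powr p * (\<Sum>n. norm (x n) powr p)) powr (1/p)"
        using suminf_mult[OF s] by (simp add: lspace_def norm_scal)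
      also have "\<dots> = norm c * vnorm ?X x"
        using p s by (simp add: lspace_def powr_mult powr_powr suminf_nonneg)
      finally show ?thesis .
    qed
  qed (rule minkowski)
qed

text \<open>The formula for this norm is nonnegative and symmetric under exchange of
  \<open>x\<close> and \<open>y\<close> even off the carrier, so no truncation of the distance is
  required.\<close>

lemma Metric_space_lspace:
  "Metric_space (vecs (lspace p)) (\<lambda>x y :: nat \<Rightarrow> 'k::real_normed_field. vnorm (lspace p) (x - y))"
proof -
  interpret normed_nspace "lspace p :: ('k, nat \<Rightarrow> 'k) nspace" by (rule normed_lspace)
  show ?thesis
  proof
    fix x y z :: "nat \<Rightarrow> 'k"
    show "0 \<le> vnorm (lspace p) (x - y)" by (rule vnorm_lspace_nonneg)
    show "vnorm (lspace p) (x - y) = vnorm (lspace p) (y - x)"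
      by (simp add: lspace_def norm_minus_commute)
    show "vnorm (lspace p) (x - y) = 0 \<longleftrightarrow> x = y" if "x \<in> vecs (lspace p)" "y \<in> vecs (lspace p)"
      using vnorm_eq_0[of "x - y"] diff_vecs[OF that] by auto
    show "vnorm (lspace p) (x - z) \<le> vnorm (lspace p) (x - y) + vnorm (lspace p) (y - z)"
      if "x \<in> vecs (lspace p)" "y \<in> vecs (lspace p)" "z \<in> vecs (lspace p)"
      by (rule vnorm_triangle_via[OF that])
  qed
qed

text \<open>Each coordinate is Cauchy and converges. The norm bound passes to the limit on the first
  \<open>m\<close> coordinates, uniformly in \<open>m\<close>, and \<open>lspaceI\<close> then
  bounds the whole difference \<open>u n - a\<close>.\<close>

lemma complete_lspace:
  "normed_nspace.complete_nspace (lspace p :: ('k::{real_normed_field, euclidean_space}, nat \<Rightarrow> 'k) nspace)"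
proof -
  let ?X = "lspace p :: ('k, nat \<Rightarrow> 'k) nspace"
  interpret X: normed_nspace ?X by (rule normed_lspace)
  show ?thesis
    unfolding X.complete_nspace_def
  proof (intro allI impI)
    fix u assume u: "range u \<subseteq> vecs ?X" and cauchy: "X.cauchy u"
    have uX: "u n \<in> vecs ?X" for n using u by auto
    have "Cauchy (\<lambda>n. u n i)" for i
    proof (rule metric_CauchyI)
      fix e :: real assume "0 < e"
      then obtain N where N: "\<And>m n. m \<ge> N \<Longrightarrow> n \<ge> N \<Longrightarrow> vnorm ?X (u m - u n) < e"
        using cauchy unfolding X.cauchy_def by metis
      have "dist (u m i) (u n i) < e" if "m \<ge> N" "n \<ge> N" for m n
        using norm_coord_le[of "u m - u n" i] N[OF that] uX by (simp add: dist_norm)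
      then show "\<exists>N. \<forall>m\<ge>N. \<forall>n\<ge>N. dist (u m i) (u n i) < e" by blast
    qed
    then have "\<exists>l. (\<lambda>n. u n i) \<longlonglongrightarrow> l" for i
      using Cauchy_convergent convergent_def by blast
    then obtain a where a: "\<And>i. (\<lambda>n. u n i) \<longlonglongrightarrow> a i" by metis
    have close: "\<exists>N. \<forall>n\<ge>N. u n - a \<in> vecs ?X \<and> vnorm ?X (u n - a) \<le> e" if e: "0 < e" for e
    proof -
      obtain N where N: "\<And>m n. m \<ge> N \<Longrightarrow> n \<ge> N \<Longrightarrow> vnorm ?X (u m - u n) < e"
        using cauchy e unfolding X.cauchy_def by metis
      have "(\<Sum>i<m. norm ((u n - a) i) powr p) \<le> e powr p" if n: "n \<ge> N" for n m
      proof (rule LIMSEQ_le_const2)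
        show "(\<lambda>k. \<Sum>i<m. norm ((u n - u k) i) powr p) \<longlonglongrightarrow> (\<Sum>i<m. norm ((u n - a) i) powr p)"
          unfolding minus_apply using p
          by (intro tendsto_sum tendsto_powr' tendsto_norm tendsto_diff tendsto_const a) auto
        have "(\<Sum>i<m. norm ((u n - u k) i) powr p) \<le> e powr p" if "k \<ge> N" for k
        proof -
          have "(\<Sum>i<m. norm ((u n - u k) i) powr p) \<le> vnorm ?X (u n - u k) powr p"
            by (intro sum_norm_powr_le X.diff_vecs uX)
          also have "\<dots> \<le> e powr p"
            using N[OF n that] p vnorm_lspace_nonneg by (intro powr_mono2) auto
          finally show ?thesis .
        qed
        then show "\<exists>N. \<forall>k\<ge>N. (\<Sum>i<m. norm ((u n - u k) i) powr p) \<le> e powr p" by blast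
      qed
      then show ?thesis using lspaceI[of e "u _ - a"] e by (metis less_imp_le)
    qed
    have "a \<in> vecs ?X"
    proof -
      obtain n where "u n - a \<in> vecs ?X" using close[of 1] by auto
      then have "u n - (u n - a) \<in> vecs ?X" using uX by blast
      then show ?thesis by simp
    qed
    moreover have "X.converges u a"
      unfolding X.converges_def
    proof (rule LIMSEQ_I)
      fix e :: real assume e: "0 < e"
      then obtain N where "\<And>n. n \<ge> N \<Longrightarrow> vnorm ?X (u n - a) \<le> e/2" using close[of "e/2"] by auto
      then have "norm (vnorm ?X (u n - a) - 0) < e" if "n \<ge> N" for n
        using that e vnorm_lspace_nonneg[of "u n - a"] by fastforce
      then show "\<exists>N. \<forall>n\<ge>N. norm (vnorm ?X (u n - a) - 0) < e" by blast
    qed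
    ultimately show "\<exists>a\<in>vecs ?X. X.converges u a" by blast
  qed
qed

lemma coord_dual:
  "(\<lambda>x. if x \<in> vecs (lspace p) then x j else 0)
    \<in> vecs (dual (lspace p :: ('k::real_normed_field, nat \<Rightarrow> 'k) nspace))"
proof -
  interpret X: normed_nspace "lspace p :: ('k, nat \<Rightarrow> 'k) nspace" by (rule normed_lspace)
  show ?thesis
    using X.scal_vecs by (intro X.dualI[where C = 1]) (auto simp: norm_coord_le scal_lspace)
qed

end

section \<open>Unconditional frames are Besselian\<close>

lemma bij_of_blocks:
  fixes N :: "nat \<Rightarrow> nat"
  assumes N: "strict_mono N" "N 0 = 0"
    and \<sigma>: "\<And>k. bij_betw (\<sigma> k) {N k..<N (Suc k)} {N k..<N (Suc k)}"
  obtains \<pi> where "bij \<pi>" "\<And>k n. n \<in> {N k..<N (Suc k)} \<Longrightarrow> \<pi> n = \<sigma> k n"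
proof -
  have ex: "\<exists>k. n \<in> {N k..<N (Suc k)}" for n
  proof -
    have "n < N (Suc n)" using strict_mono_imp_increasing[OF N(1), of "Suc n"] by simp
    then have ex1: "\<exists>k. n < N (Suc k)" by blast
    define k where "k = (LEAST k. n < N (Suc k))"
    have "n < N (Suc k)" unfolding k_def using ex1 by (rule LeastI_ex)
    moreover have "N k \<le> n"
    proof (cases k)
      case (Suc j)
      then have "\<not> n < N (Suc j)" unfolding k_def by (intro not_less_Least) simp
      then show ?thesis using Suc by simp
    qed (use N in auto)
    ultimately show ?thesis by auto
  qed
  have uniq: "k = l" if "n \<in> {N k..<N (Suc k)}" "n \<in> {N l..<N (Suc l)}" for n k l
  proof -
    have "\<not> Suc k \<le> l" "\<not> Suc l \<le> k"
      using that strict_mono_less_eq[OF N(1), of "Suc k" l] strict_mono_less_eq[OF N(1), of "Suc l" k]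
      by auto
    then show ?thesis by simp
  qed
  define blk where "blk n = (SOME k. n \<in> {N k..<N (Suc k)})" for n
  have blk: "n \<in> {N (blk n)..<N (Suc (blk n))}" for n
    unfolding blk_def using ex by (rule someI_ex)
  have blk_eq: "blk n = k" if "n \<in> {N k..<N (Suc k)}" for n k
    using uniq[OF blk that] .
  define \<pi> where "\<pi> n = \<sigma> (blk n) n" for n
  have \<pi>: "\<pi> n = \<sigma> k n" if "n \<in> {N k..<N (Suc k)}" for k n
    using blk_eq[OF that] by (simp add: \<pi>_def)
  have mem: "\<pi> n \<in> {N (blk n)..<N (Suc (blk n))}" for n
    using bij_betwE[OF \<sigma>] blk unfolding \<pi>_def by blast
  have "bij \<pi>"
  proof (rule bijI)
    show "inj \<pi>"
    proof (rule injI)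
      fix m n assume eq: "\<pi> m = \<pi> n"
      then have "blk m = blk n" using uniq[OF mem[of m]] mem[of n] by simp
      then show "m = n"
        using eq bij_betw_imp_inj_on[OF \<sigma>[of "blk m"]] blk[of m] blk[of n]
        unfolding \<pi>_def inj_on_def by metis
    qed
    show "surj \<pi>"
      unfolding surj_def
    proof
      fix n
      obtain k where k: "n \<in> {N k..<N (Suc k)}" using ex by blast
      then obtain m where "m \<in> {N k..<N (Suc k)}" "n = \<sigma> k m"
        using bij_betw_imp_surj_on[OF \<sigma>[of k]] by blast
      then show "\<exists>m. n = \<pi> m" using \<pi> by metis
    qed
  qed
  then show thesis using \<pi> that by blast
qed

text \<open>Moving \<open>F\<close> to the front of its block makes the sum over \<open>F\<close> a
  difference of two partial sums of the rearranged series.\<close>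

lemma bij_interval_front:
  fixes F :: "nat set"
  assumes "F \<subseteq> {a..<b}" "a \<le> b"
  obtains \<sigma> where "bij_betw \<sigma> {a..<b} {a..<b}" "\<sigma> ` {a..<a + card F} = F" "a + card F \<le> b"
proof -
  have fin: "finite F" using assms(1) finite_subset by blast
  have card: "card F \<le> b - a" using card_mono[OF _ assms(1)] by simp
  have le: "a + card F \<le> b" using card \<open>a \<le> b\<close> by simp
    obtain f where f: "bij_betw f {a..<a + card F} F"
      using finite_same_card_bij[of "{a..<a + card F}" F] fin by auto
    have "card ({a..<b} - F) = card {a + card F..<b}"
      using assms fin by (simp add: card_Diff_subset)
    then obtain g where g: "bij_betw g {a + card F..<b} ({a..<b} - F)"
      using finite_same_card_bij[of "{a + card F..<b}" "{a..<b} - F"] by auto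
    define \<sigma> where "\<sigma> n = (if n \<in> {a..<a + card F} then f n else g n)" for n
    have 1: "bij_betw \<sigma> {a..<a + card F} F"
      using f by (subst bij_betw_cong[where g = f]) (auto simp: \<sigma>_def)
    have 2: "bij_betw \<sigma> {a + card F..<b} ({a..<b} - F)"
      using g by (subst bij_betw_cong[where g = g]) (auto simp: \<sigma>_def)
    have "bij_betw \<sigma> ({a..<a + card F} \<union> {a + card F..<b}) (F \<union> ({a..<b} - F))"
      using 1 2 by (rule bij_betw_combine) auto
    moreover have "{a..<a + card F} \<union> {a + card F..<b} = {a..<b}" using le by auto
    moreover have "F \<union> ({a..<b} - F) = {a..<b}" using assms by auto
    ultimately show thesis using 1 le that by (metis bij_betw_imp_surj_on)
qed

section \<open>Finite partial sums of unconditionally convergent series\<close>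

context normed_nspace
begin

lemma series_converges_iff: "series_converges_to X u s \<longleftrightarrow> converges (\<lambda>N. \<Sum>n<N. u n) s"
  by (simp add: series_converges_to_def converges_def)

text \<open>If the tails of the finite partial sums did not become small, a permutation that lists
  bad finite sets first in successive blocks would make the rearranged series diverge.\<close>

lemma unconditional_finite_tails:
  assumes u: "\<And>n. u n \<in> vecs X" and unc: "unconditionally_convergent X u" and "0 < e"
  shows "\<exists>N. \<forall>F. finite F \<longrightarrow> F \<subseteq> {N..} \<longrightarrow> vnorm X (sum u F) < e"
proof (rule ccontr)
  assume "\<not> ?thesis"
  then have "\<forall>N. \<exists>F. finite F \<and> F \<subseteq> {N..} \<and> e \<le> vnorm X (sum u F)" by (simp add: not_less)
  then obtain F where F: "\<And>N. finite (F N)" "\<And>N. F N \<subseteq> {N..}" "\<And>N. e \<le> vnorm X (sum u (F N))"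
    by metis
  \<comment> \<open>The next block starts one past the largest element of \<open>F N\<close>;
    \<open>insert N\<close> makes it start beyond \<open>N\<close> as well.\<close>
  define step where "step N = Suc (Max (insert N (F N)))" for N
  have step: "N < step N" "F N \<subseteq> {N..<step N}" for N
    using F(1,2)[of N] by (auto simp: step_def less_Suc_eq_le)
  define N where "N k = (step ^^ k) 0" for k
  have NS: "N (Suc k) = step (N k)" for k by (simp add: N_def)
  have N: "strict_mono N" "N 0 = 0" by (simp_all add: strict_mono_Suc_iff NS step) (simp add: N_def)
  have "\<exists>\<sigma>. bij_betw \<sigma> {N k..<N (Suc k)} {N k..<N (Suc k)} \<and>
      \<sigma> ` {N k..<N k + card (F (N k))} = F (N k) \<and> N k + card (F (N k)) \<le> N (Suc k)" for k
    using bij_interval_front[of "F (N k)" "N k" "N (Suc k)"] step[of "N k"] unfolding NS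
    by (metis less_imp_le)
  then obtain \<sigma> where \<sigma>: "\<And>k. bij_betw (\<sigma> k) {N k..<N (Suc k)} {N k..<N (Suc k)}"
      "\<And>k. \<sigma> k ` {N k..<N k + card (F (N k))} = F (N k)" "\<And>k. N k + card (F (N k)) \<le> N (Suc k)"
    by metis
  obtain \<pi> where \<pi>: "bij \<pi>" "\<And>k n. n \<in> {N k..<N (Suc k)} \<Longrightarrow> \<pi> n = \<sigma> k n"
    using bij_of_blocks[OF N \<sigma>(1)] by blast
  obtain s where s: "s \<in> vecs X" "converges (\<lambda>N. \<Sum>n<N. (u \<circ> \<pi>) n) s"
    using unc \<pi>(1) unfolding unconditionally_convergent_def series_converges_iff by blast
  have "cauchy (\<lambda>N. \<Sum>n<N. (u \<circ> \<pi>) n)"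
    using s u by (intro converges_imp_cauchy) (auto intro!: sum_vecs)
  then obtain M where M: "\<And>m n. m \<ge> M \<Longrightarrow> n \<ge> M \<Longrightarrow> vnorm X ((\<Sum>n<m. (u \<circ> \<pi>) n) - (\<Sum>n<n. (u \<circ> \<pi>) n)) < e"
    using \<open>0 < e\<close> unfolding cauchy_def by metis
  \<comment> \<open>Both indices are at least \<open>M\<close>, so these partial sums are closer
    than \<open>e\<close>, although they differ by the bad sum over \<open>F (N M)\<close>.\<close>
  let ?a = "N M" and ?b = "N M + card (F (N M))"
  have "M \<le> ?a" using strict_mono_imp_increasing[OF N(1)] by blast
  have img: "\<pi> ` {?a..<?b} = F (N M)"
  proof -
    have "\<pi> ` {?a..<?b} = \<sigma> M ` {?a..<?b}"
      using \<pi>(2)[of _ M] \<sigma>(3)[of M] by (intro image_cong) auto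
    then show ?thesis using \<sigma>(2) by simp
  qed
  have "(\<Sum>n<?b. (u \<circ> \<pi>) n) - (\<Sum>n<?a. (u \<circ> \<pi>) n) = (\<Sum>n\<in>{?a..<?b}. (u \<circ> \<pi>) n)"
    by (simp add: lessThan_atLeast0 sum_diff_nat_ivl del: o_apply)
  also have "\<dots> = sum u (F (N M))"
    using sum.reindex[of \<pi> "{?a..<?b}" u] inj_on_subset[OF bij_is_inj[OF \<pi>(1)]] by (simp only: img subset_UNIV)
  finally show False using M[of ?b ?a] \<open>M \<le> ?a\<close> F(3)[of "N M"] by simp
qed

text \<open>Indices below some \<open>N\<close> contribute at most a fixed finite sum of norms, the
  others less than 1.\<close>

lemma unconditional_bounded:
  assumes u: "\<And>n. u n \<in> vecs X" and unc: "unconditionally_convergent X u"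
  shows "\<exists>K. \<forall>F. finite F \<longrightarrow> vnorm X (sum u F) \<le> K"
proof -
  obtain N where N: "\<And>F. finite F \<Longrightarrow> F \<subseteq> {N..} \<Longrightarrow> vnorm X (sum u F) < 1"
    using unconditional_finite_tails[OF u unc, of 1] by auto
  have "vnorm X (sum u F) \<le> (\<Sum>n<N. vnorm X (u n)) + 1" if "finite F" for F
  proof -
    have "sum u F = sum u (F \<inter> {..<N}) + sum u (F \<inter> {N..})"
      using that by (subst sum.union_disjoint[symmetric]) (auto intro!: sum.cong)
    then have "vnorm X (sum u F) \<le> vnorm X (sum u (F \<inter> {..<N})) + vnorm X (sum u (F \<inter> {N..}))"
      using u by (simp add: vnorm_triangle sum_vecs)
    also have "\<dots> \<le> (\<Sum>n\<in>F \<inter> {..<N}. vnorm X (u n)) + 1"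
      using N[of "F \<inter> {N..}"] that u by (intro add_mono vnorm_sum) auto
    also have "(\<Sum>n\<in>F \<inter> {..<N}. vnorm X (u n)) \<le> (\<Sum>n<N. vnorm X (u n))"
      using u by (intro sum_mono2) auto
    finally show ?thesis by simp
  qed
  then show ?thesis by blast
qed

end

text \<open>In one real coordinate the terms of either sign form a subset sum bounded by
  \<open>K\<close>, which gives \<open>2 * K\<close>; then add over the \<open>DIM('k)\<close>
  coordinates.\<close>

lemma sum_norm_le_finite_sums:
  fixes z :: "'i \<Rightarrow> 'k::euclidean_space" and K :: real
  assumes "finite A" and K: "\<And>F. F \<subseteq> A \<Longrightarrow> norm (sum z F) \<le> K"
  shows "(\<Sum>n\<in>A. norm (z n)) \<le> 2 * DIM('k) * K"
proof -
  have "(\<Sum>n\<in>A. \<bar>z n \<bullet> b\<bar>) \<le> 2 * K" if b: "b \<in> Basis" for b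
  proof -
    let ?P = "{n\<in>A. 0 \<le> z n \<bullet> b}"
    let ?Q = "A - ?P"
    have le: "\<bar>\<Sum>n\<in>F. z n \<bullet> b\<bar> \<le> K" if "F \<subseteq> A" for F
    proof -
      have "\<bar>\<Sum>n\<in>F. z n \<bullet> b\<bar> = \<bar>sum z F \<bullet> b\<bar>" by (simp add: inner_sum_left)
      also have "\<dots> \<le> norm (sum z F)" using b by (rule Basis_le_norm)
      finally show ?thesis using K[OF that] by simp
    qed
    have "(\<Sum>n\<in>A. \<bar>z n \<bullet> b\<bar>) = (\<Sum>n\<in>?Q. \<bar>z n \<bullet> b\<bar>) + (\<Sum>n\<in>?P. \<bar>z n \<bullet> b\<bar>)"
      using \<open>finite A\<close> by (intro sum.subset_diff) auto
    also have "(\<Sum>n\<in>?Q. \<bar>z n \<bullet> b\<bar>) = - (\<Sum>n\<in>?Q. z n \<bullet> b)"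
      by (subst sum_negf[symmetric], intro sum.cong) auto
    also have "(\<Sum>n\<in>?P. \<bar>z n \<bullet> b\<bar>) = (\<Sum>n\<in>?P. z n \<bullet> b)"
      by (intro sum.cong) auto
    finally show ?thesis using le[of ?P] le[of ?Q] by auto
  qed
  then have "(\<Sum>b\<in>(Basis::'k set). \<Sum>n\<in>A. \<bar>z n \<bullet> b\<bar>) \<le> (\<Sum>b\<in>(Basis::'k set). 2 * K)"
    by (intro sum_mono)
  moreover have "(\<Sum>n\<in>A. norm (z n)) \<le> (\<Sum>n\<in>A. \<Sum>b\<in>Basis. \<bar>z n \<bullet> b\<bar>)"
    by (intro sum_mono norm_le_l1)
  ultimately show ?thesis by (subst (asm) sum.swap) (simp add: mult_ac)
qed

lemma unconditional_imp_besselian: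
  fixes X :: "('k::{real_normed_field, euclidean_space}, 'v::ab_group_add) nspace"
  assumes "normed_nspace X" "normed_nspace.complete_nspace X" "unconditional_schauder_frame X a b"
  shows "besselian_schauder_frame X a b"
proof -
  interpret X: normed_nspace X by fact
  interpret Dual: normed_nspace "dual X" by (rule X.normed_dual)
  have frame: "schauder_frame X a b"
    and unc: "\<And>x. x \<in> vecs X \<Longrightarrow> unconditionally_convergent X (\<lambda>n. scal X (b n x) (a n))"
    using assms(3) by (auto simp: unconditional_schauder_frame_def)
  have a: "a n \<in> vecs X" and b: "b n \<in> vecs (dual X)" for n using frame by (auto simp: schauder_frame_def)
  define w where "w x n = scal X (b n x) (a n)" for x n
  have w: "w x n \<in> vecs X" for x n using a by (simp add: w_def)
  \<comment> \<open>The seminorms are indexed by the whole type \<open>nat set\<close>; infinite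
    sets get the zero seminorm.\<close>
  define s where "s F x = vnorm X (sum (w x) (if finite F then F else {}))" for F x
  have "\<exists>B>0. \<forall>F. \<forall>x\<in>vecs X. s F x \<le> B * vnorm X x"
  proof (rule X.uniform_boundedness[OF assms(2)])
    show "s F (x + y) \<le> s F x + s F y" if "x \<in> vecs X" "y \<in> vecs X" for F x y
    proof -
      have "w (x + y) n = w x n + w y n" for n
        using X.dualD(1)[OF b that] by (simp add: w_def X.scale_left_distrib)
      then show ?thesis
        using w by (simp add: s_def sum.distrib X.vnorm_triangle X.sum_vecs)
    qed
    show "s F (scal X c x) = norm c * s F x" if "x \<in> vecs X" for F c x
    proof -
      have "w (scal X c x) n = scal X c (w x n)" for n
        using X.dualD(2)[OF b that] by (simp add: w_def)
      then show ?thesis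
        using w by (simp add: s_def X.vnorm_scal X.sum_vecs flip: X.scale_sum_right)
    qed
    show "\<exists>C. \<forall>x\<in>vecs X. s F x \<le> C * vnorm X x" for F
    proof (intro exI ballI)
      fix x assume x: "x \<in> vecs X"
      let ?F = "if finite F then F else {}"
      have "s F x \<le> (\<Sum>n\<in>?F. vnorm X (w x n))" unfolding s_def by (intro X.vnorm_sum w)
      also have "\<dots> \<le> (\<Sum>n\<in>?F. vnorm (dual X) (b n) * vnorm X x * vnorm X (a n))"
      proof (intro sum_mono)
        fix n
        have "vnorm X (w x n) = norm (b n x) * vnorm X (a n)" using a by (simp add: w_def X.vnorm_scal)
        then show "vnorm X (w x n) \<le> vnorm (dual X) (b n) * vnorm X x * vnorm X (a n)"
          using X.dualD(3)[OF b x] a by (simp add: mult_right_mono)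
      qed
      also have "\<dots> = (\<Sum>n\<in>?F. vnorm (dual X) (b n) * vnorm X (a n)) * vnorm X x"
        by (subst sum_distrib_right) (simp only: mult_ac)
      finally show "s F x \<le> (\<Sum>n\<in>?F. vnorm (dual X) (b n) * vnorm X (a n)) * vnorm X x" .
    qed
    show "\<exists>K. \<forall>F. s F x \<le> K" if x: "x \<in> vecs X" for x
    proof -
      have "w x = (\<lambda>n. scal X (b n x) (a n))" by (simp add: w_def fun_eq_iff)
      then obtain K where "\<And>F. finite F \<Longrightarrow> vnorm X (sum (w x) F) \<le> K"
        using X.unconditional_bounded[of "w x", OF w] unc[OF x] by auto
      then show ?thesis by (intro exI[of _ K]) (simp add: s_def)
    qed
  qed
  then obtain B where B: "0 < B" "\<And>F x. x \<in> vecs X \<Longrightarrow> s F x \<le> B * vnorm X x" by blast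
  \<comment> \<open>\<open>B\<close> controls the finite sums of \<open>b n x * y (a n)\<close>;
    passing to absolute values costs \<open>2 * DIM('k)\<close>.\<close>
  define C where "C = 2 * DIM('k) * B"
  have main: "(\<Sum>n<N. norm (b n x) * norm (y (a n))) \<le> C * vnorm X x * vnorm (dual X) y"
    if x: "x \<in> vecs X" and y: "y \<in> vecs (dual X)" for x y N
  proof -
    have "norm (\<Sum>n\<in>F. b n x * y (a n)) \<le> vnorm (dual X) y * (B * vnorm X x)" if "F \<subseteq> {..<N}" for F
    proof -
      have fin: "finite F" using that finite_subset by blast
      have wF: "sum (w x) F \<in> vecs X" using w by (intro X.sum_vecs)
      have "(\<Sum>n\<in>F. b n x * y (a n)) = y (sum (w x) F)"
        unfolding X.dualD(4)[OF y w] using X.dualD(2)[OF y a] by (simp add: w_def)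
      also have "norm \<dots> \<le> vnorm (dual X) y * vnorm X (sum (w x) F)" using X.dualD(3)[OF y wF] .
      also have "\<dots> \<le> vnorm (dual X) y * (B * vnorm X x)"
        using B(2)[OF x, of F] fin y by (intro mult_left_mono) (auto simp: s_def)
      finally show ?thesis .
    qed
    then have "(\<Sum>n\<in>{..<N}. norm (b n x * y (a n))) \<le> 2 * DIM('k) * (vnorm (dual X) y * (B * vnorm X x))"
      by (intro sum_norm_le_finite_sums) auto
    then show ?thesis by (simp add: norm_mult C_def mult_ac)
  qed
  have "summable (\<lambda>n. norm (b n x) * norm (y (a n))) \<and>
      (\<Sum>n. norm (b n x) * norm (y (a n))) \<le> C * vnorm X x * vnorm (dual X) y"
    if "x \<in> vecs X" "y \<in> vecs (dual X)" for x y
  proof -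
    have "summable (\<lambda>n. norm (b n x) * norm (y (a n)))"
      using main[OF that] by (intro summableI_nonneg_bounded) auto
    then show ?thesis using main[OF that] suminf_le_const by blast
  qed
  moreover have "0 < C" using B(1) by (simp add: C_def)
  ultimately show ?thesis using frame unfolding besselian_schauder_frame_def by blast
qed

section \<open>Besselian frames of spaces of compact operators\<close>

lemma operator_pair_lspace:
  assumes "1 \<le> p" "1 \<le> q"
  shows "operator_pair (lspace p :: ('k::{real_normed_field, euclidean_space}, nat \<Rightarrow> 'k) nspace) (lspace q)"
proof -
  interpret X: normed_nspace "lspace p :: ('k, nat \<Rightarrow> 'k) nspace" by (rule normed_lspace[OF assms(1)])
  interpret Y: normed_nspace "lspace q :: ('k, nat \<Rightarrow> 'k) nspace" by (rule normed_lspace[OF assms(2)])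
  interpret Y: Metric_space "vecs (lspace q)" "\<lambda>x y :: nat \<Rightarrow> 'k. vnorm (lspace q) (x - y)"
    by (rule Metric_space_lspace[OF assms(2)])
  show ?thesis by standard (rule complete_lspace[OF assms(2)])
qed

lemma sum_fun_apply: "sum f A x = (\<Sum>a\<in>A. f a x)"
  by (induction A rule: infinite_finite_induct) auto

locale lspace_operators =
  fixes p q :: real and E :: "('k::{real_normed_field, euclidean_space}, (nat \<Rightarrow> 'k) \<Rightarrow> (nat \<Rightarrow> 'k)) nspace"
  assumes q: "1 < q" and p: "q < p"
    and E_def: "E = compact_ops (lspace p) (lspace q)"
begin

abbreviation P :: "('k, nat \<Rightarrow> 'k) nspace" where "P \<equiv> lspace p"
abbreviation Q :: "('k, nat \<Rightarrow> 'k) nspace" where "Q \<equiv> lspace q"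

lemma p1: "1 \<le> p" and q1: "1 \<le> q" using p q by simp_all

sublocale PQ: operator_pair P Q
  by (rule operator_pair_lspace[OF p1 q1])

sublocale E: normed_nspace E
  unfolding E_def by (rule PQ.normed_compact_ops)

lemmas EI = PQ.compact_opsD[folded E_def]

lemma scal_E: "scal E c T = (\<lambda>x l. c * T x l)"
  by (simp add: E_def compact_ops_def lspace_def)

definition unit :: "nat \<Rightarrow> nat \<Rightarrow> 'k" where
  "unit j i = (if i = j then 1 else 0)"

lemma unit_vecs: "1 \<le> r \<Longrightarrow> unit j \<in> vecs (lspace r)"
  by (rule vnorm_finite_support(1)[of r "Suc j"]) (auto simp: unit_def)

lemma vnorm_unit: "1 \<le> r \<Longrightarrow> vnorm (lspace r) (unit j) = 1"
  by (subst vnorm_finite_support(2)[of r "Suc j"]) (auto simp: unit_def if_distrib[of norm] if_distrib[of "\<lambda>t. t powr r"] cong: if_cong)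

text \<open>Written as a rank-one operator with the functional of \<open>coord_dual\<close>, so that
  \<open>rank_one_compact\<close> applies.\<close>

definition matrix_unit :: "nat \<Rightarrow> nat \<Rightarrow> (nat \<Rightarrow> 'k) \<Rightarrow> nat \<Rightarrow> 'k" where
  "matrix_unit i j = (\<lambda>x. scal Q (if x \<in> vecs P then x j else 0) (unit i))"

lemma matrix_unit_vecs: "matrix_unit i j \<in> vecs E"
  unfolding E_def matrix_unit_def
  by (intro PQ.rank_one_compact coord_dual unit_vecs p1 q1)

lemma matrix_unit_apply: "x \<in> vecs P \<Longrightarrow> matrix_unit i j x l = (if l = i then x j else 0)"
  by (simp add: matrix_unit_def scal_lspace[OF q1] unit_def)

definition matrix_op :: "nat \<Rightarrow> (nat \<Rightarrow> nat \<Rightarrow> real) \<Rightarrow> (nat \<Rightarrow> 'k) \<Rightarrow> nat \<Rightarrow> 'k" where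
  "matrix_op m h = (\<Sum>i<m. \<Sum>j<m. scal E (of_real (h i j)) (matrix_unit i j))"

lemma matrix_op_vecs: "matrix_op m h \<in> vecs E"
  unfolding matrix_op_def by (intro E.sum_vecs E.scal_vecs matrix_unit_vecs)

lemma matrix_op_apply:
  assumes "x \<in> vecs P"
  shows "matrix_op m h x l = (if l < m then \<Sum>j<m. h l j *\<^sub>R x j else 0)"
proof -
  have "matrix_op m h x l = (\<Sum>i<m. \<Sum>j<m. of_real (h i j) * (if l = i then x j else 0))"
    by (simp add: matrix_op_def sum_fun_apply scal_E matrix_unit_apply[OF assms])
  also have "\<dots> = (\<Sum>i<m. if l = i then \<Sum>j<m. h i j *\<^sub>R x j else 0)"
    by (intro sum.cong refl) (auto simp: scaleR_conv_of_real)
  finally show ?thesis by simp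
qed

text \<open>Entries of modulus 1 leave the Hilbert-Schmidt norm of the coefficients
  \<open>b (matrix_unit i j)\<close> unchanged, yet the operator norm is small since the Walsh
  matrix is a multiple of an isometry. \<open>fst z\<close> gives the row signs and
  \<open>snd z\<close> the column signs.\<close>

definition signed_walsh :: "nat \<Rightarrow> nat set \<times> nat set \<Rightarrow> (nat \<Rightarrow> 'k) \<Rightarrow> nat \<Rightarrow> 'k" where
  "signed_walsh k z = matrix_op (2 ^ k) (\<lambda>i j. sign_of (fst z) i * sign_of (snd z) j * walsh k i j)"

text \<open>The exponent follows the factorisation l_p -> l_2 -> l_2 -> l_q on \<open>2 ^ k\<close>
  coordinates: \<open>1/2\<close> comes from \<open>walsh_isometry\<close>, the two maxima from the
  changes of norm by \<open>sum_powr_compare\<close>.\<close>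

lemma vnorm_signed_walsh:
  "vnorm E (signed_walsh k z) \<le> (2 ^ k) powr (1/2 + max 0 (1/q - 1/2) + max 0 (1/2 - 1/p))"
proof -
  define m :: nat where "m = 2 ^ k"
  define c :: real where "c = m powr (1/2 + max 0 (1/q - 1/2) + max 0 (1/2 - 1/p))"
  have "op_norm P Q (signed_walsh k z) \<le> c"
  proof (rule PQ.op_norm_le)
    show "0 \<le> c" by (simp add: c_def)
    fix x assume x: "x \<in> vecs P"
    \<comment> \<open>The column signs are absorbed into the vector without changing its norm; the
      row signs disappear on taking norms of coordinates.\<close>
    define y where "y i = (\<Sum>j<m. walsh k i j *\<^sub>R (sign_of (snd z) j *\<^sub>R x j))" for i
    have Tx: "signed_walsh k z x i = (if i < m then sign_of (fst z) i *\<^sub>R y i else 0)" for i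
      using matrix_op_apply[OF x] by (simp add: signed_walsh_def m_def y_def scaleR_sum_right mult_ac)
    have "vnorm Q (signed_walsh k z x) = (\<Sum>i<m. norm (signed_walsh k z x i) powr q) powr (1/q)"
      by (rule vnorm_finite_support(2)[OF q1]) (simp add: Tx)
    also have "\<dots> = (\<Sum>i<m. norm (y i) powr q) powr (1/q)"
      by (simp add: Tx)
    also have "\<dots> \<le> real (card {..<m}) powr max 0 (1/q - 1/2) * (\<Sum>i<m. norm (y i) powr 2) powr (1/2)"
      using q by (intro sum_powr_compare) auto
    also have "(\<Sum>i<m. norm (y i) powr 2) = m * (\<Sum>j<m. norm (x j) powr 2)"
      using walsh_isometry[of k "\<lambda>j. sign_of (snd z) j *\<^sub>R x j"] by (simp add: y_def m_def)
    also have "(real m * (\<Sum>j<m. norm (x j) powr 2)) powr (1/2) = m powr (1/2) * (\<Sum>j<m. norm (x j) powr 2) powr (1/2)"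
      by (simp add: powr_mult sum_nonneg)
    also have "real (card {..<m}) powr max 0 (1/q - 1/2) * \<dots>
        \<le> real (card {..<m}) powr max 0 (1/q - 1/2) * (m powr (1/2) *
          (real (card {..<m}) powr max 0 (1/2 - 1/p) * (\<Sum>j<m. norm (x j) powr p) powr (1/p)))"
      using p q by (intro mult_left_mono sum_powr_compare) auto
    also have "\<dots> = c * (\<Sum>j<m. norm (x j) powr p) powr (1/p)"
      by (simp add: c_def powr_add)
    also have "\<dots> \<le> c * vnorm P x"
      using sum_norm_le_vnorm[OF p1 x] by (intro mult_left_mono) (auto simp: c_def)
    finally show "vnorm Q (signed_walsh k z x) \<le> c * vnorm P x" .
  qed
  then show ?thesis by (simp add: E_def compact_ops_def c_def m_def)
qed

text \<open>The operator is applied to the vector of column signs and paired with the row signs.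
  Membership in \<open>dual E\<close> forces the value 0 off \<open>vecs E\<close>.\<close>

definition sign_functional :: "nat \<Rightarrow> nat set \<times> nat set \<Rightarrow> ((nat \<Rightarrow> 'k) \<Rightarrow> nat \<Rightarrow> 'k) \<Rightarrow> 'k" where
  "sign_functional m z T = (if T \<in> vecs E
    then \<Sum>i<m. \<Sum>j<m. (sign_of (fst z) i * sign_of (snd z) j) *\<^sub>R T (unit j) i else 0)"

text \<open>The column-sign vector \<open>s\<close> has norm \<open>m powr (1/p)\<close>, and
  summing \<open>m\<close> coordinates of \<open>T s\<close> costs \<open>m powr (1 - 1/q)\<close>,
  by comparing the 1-norm with the \<open>q\<close>-norm.\<close>

lemma sign_functional_dual:
  shows "sign_functional m z \<in> vecs (dual E)"
    and "vnorm (dual E) (sign_functional m z) \<le> m powr (1/p + 1 - 1/q)"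
proof -
  define s :: "nat \<Rightarrow> 'k" where "s = (\<Sum>j<m. scal P (of_real (sign_of (snd z) j)) (unit j))"
  have s_apply: "s l = (if l < m then of_real (sign_of (snd z) l) else 0)" for l
    by (simp add: s_def sum_fun_apply scal_lspace[OF p1] unit_def if_distrib[of "(*) _"] cong: if_cong)
  have s: "s \<in> vecs P" "vnorm P s = m powr (1/p)"
    using vnorm_finite_support[OF p1, where m = m and x = s] by (auto simp: s_apply)
  have eq: "sign_functional m z T = (\<Sum>i<m. sign_of (fst z) i *\<^sub>R T s i)" if T: "T \<in> vecs E" for T
  proof -
    have "T s = (\<Sum>j<m. T (scal P (of_real (sign_of (snd z) j)) (unit j)))"
      unfolding s_def using unit_vecs[OF p1] by (intro PQ.linear_ops_sum EI(1)[OF T]) auto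
    also have "\<dots> = (\<Sum>j<m. scal Q (of_real (sign_of (snd z) j)) (T (unit j)))"
      by (intro sum.cong refl PQ.linear_opsD(3)[OF EI(1)[OF T]] unit_vecs p1)
    finally have "T s i = (\<Sum>j<m. sign_of (snd z) j *\<^sub>R T (unit j) i)" for i
      by (simp add: sum_fun_apply scal_lspace[OF q1] scaleR_conv_of_real)
    then show ?thesis using T by (simp add: sign_functional_def scaleR_sum_right)
  qed
  have bound: "norm (sign_functional m z T) \<le> m powr (1/p + 1 - 1/q) * vnorm E T" if T: "T \<in> vecs E" for T
  proof -
    have "norm (sign_functional m z T) \<le> (\<Sum>i<m. norm (T s i) powr 1) powr (1/1)"
      unfolding eq[OF T] by (simp add: sum_nonneg) (rule order_trans[OF norm_sum], simp)
    also have "\<dots> \<le> real (card {..<m}) powr max 0 (1/1 - 1/q) * (\<Sum>i<m. norm (T s i) powr q) powr (1/q)"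
      using q by (intro sum_powr_compare) auto
    also have "\<dots> \<le> real (card {..<m}) powr max 0 (1/1 - 1/q) * (vnorm E T * vnorm P s)"
      using EI(2)[OF T s(1)] sum_norm_le_vnorm[OF q1 EI(3)[OF T, of s], of m]
      by (intro mult_left_mono) auto
    also have "\<dots> = m powr (1/p + 1 - 1/q) * vnorm E T"
      using q by (simp add: s(2) powr_add[symmetric] mult_ac add_diff_eq)
    finally show ?thesis .
  qed
  have add: "sign_functional m z (S + T) = sign_functional m z S + sign_functional m z T"
    if "S \<in> vecs E" "T \<in> vecs E" for S T
    using that by (simp add: sign_functional_def scaleR_add_right sum.distrib)
  have scl: "sign_functional m z (scal E c T) = c * sign_functional m z T" if "T \<in> vecs E" for c T
    using that E.scal_vecs[OF that, of c] by (simp add: sign_functional_def scal_E sum_distrib_left)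
  show "sign_functional m z \<in> vecs (dual E)"
    and "vnorm (dual E) (sign_functional m z) \<le> m powr (1/p + 1 - 1/q)"
    by (rule E.dualI[OF bound _ add scl]; simp add: sign_functional_def)+
qed

text \<open>Evaluating an entry is contractive: the entry is at most the norm of its column, which
  is the image of a unit vector. Norm convergence of the expansion is therefore entrywise.\<close>

lemma frame_coefficients:
  assumes "schauder_frame E a b" "T \<in> vecs E"
  shows "(\<lambda>n. b n T * a n (unit j) i) sums T (unit j) i"
proof -
  have a: "a n \<in> vecs E" for n using assms by (simp add: schauder_frame_def)
  let ?S = "\<lambda>N. (\<Sum>n<N. scal E (b n T) (a n)) - T"
  have S: "?S N \<in> vecs E" for N using a assms by (intro E.diff_vecs E.sum_vecs) auto
  have "(\<lambda>N. vnorm E (?S N)) \<longlonglongrightarrow> 0"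
    using assms by (auto simp: schauder_frame_def series_converges_to_def)
  then have "(\<lambda>N. ?S N (unit j) i) \<longlonglongrightarrow> 0"
  proof (rule Lim_null_comparison[rotated])
    have "norm (?S N (unit j) i) \<le> vnorm E (?S N)" for N
      using order_trans[OF norm_coord_le[OF q1 EI(3)[OF S]] EI(2)[OF S unit_vecs[OF p1]]]
      unfolding vnorm_unit[OF p1] mult_1_right by blast
    then show "\<forall>\<^sub>F N in sequentially. norm (?S N (unit j) i) \<le> vnorm E (?S N)" by simp
  qed
  then have "(\<lambda>N. \<Sum>n<N. b n T * a n (unit j) i) \<longlonglongrightarrow> T (unit j) i"
    by (simp add: sum_fun_apply scal_E LIM_zero_iff)
  then show ?thesis by (simp add: sums_def)
qed

text \<open>Apply \<open>khinchine_double\<close> to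
  \<open>walsh k i j *\<^sub>R b (matrix_unit i j)\<close>; the Walsh factor does not affect the
  left side. The power \<open>4 ^ 2 ^ k\<close> counts the pairs of sign vectors.\<close>

lemma hilbert_schmidt_walsh:
  assumes b: "b \<in> vecs (dual E)"
  shows "4 ^ 2 ^ k * sqrt (\<Sum>i<2^k. \<Sum>j<2^k. (norm (b (matrix_unit i j)))\<^sup>2)
    \<le> 4 * (\<Sum>z\<in>Pow {..<2^k} \<times> Pow {..<2^k}. norm (b (signed_walsh k z)))"
proof -
  have "b (signed_walsh k z) = (\<Sum>i<2^k. \<Sum>j<2^k.
      (sign_of (fst z) i * sign_of (snd z) j) *\<^sub>R (walsh k i j *\<^sub>R b (matrix_unit i j)))" for z
    unfolding signed_walsh_def matrix_op_def
    using matrix_unit_vecs E.scal_vecs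
    by (simp add: E.dualD(4)[OF b] E.dualD(2)[OF b] E.sum_vecs scaleR_conv_of_real mult.assoc)
  then show ?thesis
    using khinchine_double[of "{..<2^k}" "{..<2^k}" "\<lambda>i j. walsh k i j *\<^sub>R b (matrix_unit i j)"]
    by (simp add: sum.cartesian_product split_beta flip: power_mult_distrib)
qed

lemma hilbert_schmidt_signs:
  assumes "T \<in> vecs E"
  shows "4 ^ m * sqrt (\<Sum>i<m. \<Sum>j<m. (norm (T (unit j) i))\<^sup>2)
    \<le> 4 * (\<Sum>z\<in>Pow {..<m} \<times> Pow {..<m}. norm (sign_functional m z T))"
  using khinchine_double[of "{..<m}" "{..<m}" "\<lambda>i j. T (unit j) i"] assms
  by (simp add: sum.cartesian_product split_beta sign_functional_def flip: power_mult_distrib)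

text \<open>The norms of \<open>signed_walsh\<close> and \<open>sign_functional\<close> multiply, so
  their exponents add up on the right; \<open>(2 ^ k) powr 2\<close> counts the matrix
  units.\<close>

lemma besselian_trace_bound:
  assumes frame: "schauder_frame E a b"
    and bess: "\<And>x y. x \<in> vecs E \<Longrightarrow> y \<in> vecs (dual E) \<Longrightarrow>
       summable (\<lambda>n. norm (b n x) * norm (y (a n))) \<and>
       (\<Sum>n. norm (b n x) * norm (y (a n))) \<le> B * vnorm E x * vnorm (dual E) y"
    and "0 < B"
  shows "(2 ^ k) powr 2 \<le> 16 * B * (2 ^ k) powr
    (1/2 + max 0 (1/q - 1/2) + max 0 (1/2 - 1/p) + (1/p + 1 - 1/q))"
proof -
  interpret D: normed_nspace "dual E" by (rule E.normed_dual)
  have a: "a n \<in> vecs E" and b: "b n \<in> vecs (dual E)" for n using frame by (auto simp: schauder_frame_def)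
  define m :: nat where "m = 2 ^ k"
  define Z where "Z = Pow {..<m} \<times> Pow {..<m}"
  have Z: "finite Z" "real (card Z) = 4 ^ m"
    by (simp_all add: Z_def card_cartesian_product card_Pow flip: power_mult_distrib)
  define G where "G = real m powr (1/2 + max 0 (1/q - 1/2) + max 0 (1/2 - 1/p))"
  define F where "F = real m powr (1/p + 1 - 1/q)"
  define t where "t n z z' = norm (b n (signed_walsh k z)) * norm (sign_functional m z' (a n))" for n z z'
  have t: "summable (\<lambda>n. t n z z')" "(\<Sum>n. t n z z') \<le> B * G * F" for z z'
  proof -
    have g: "signed_walsh k z \<in> vecs E" by (simp add: signed_walsh_def matrix_op_vecs)
    note f = sign_functional_dual[of m z']
    show "summable (\<lambda>n. t n z z')" using bess[OF g f(1)] by (simp add: t_def)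
    have "(\<Sum>n. t n z z') \<le> B * vnorm E (signed_walsh k z) * vnorm (dual E) (sign_functional m z')"
      using bess[OF g f(1)] by (simp add: t_def)
    also have "\<dots> \<le> B * G * F"
      using vnorm_signed_walsh[of k z] f \<open>0 < B\<close> g by (intro mult_mono) (auto simp: G_def F_def m_def)
    finally show "(\<Sum>n. t n z z') \<le> B * G * F" .
  qed
  \<comment> \<open>A majorant of the \<open>n\<close>-th term: each of the two Khinchine
    inequalities contributes a factor 4 and an average over \<open>4 ^ m\<close> sign pairs.\<close>
  define w where "w n = 16 / 16 ^ m * (\<Sum>z\<in>Z. \<Sum>z'\<in>Z. t n z z')" for n
  \<comment> \<open>Each matrix unit has the entry 1 at its own position, so adding the expansions
    of these entries gives \<open>m * m\<close>.\<close>
  have "(\<lambda>n. \<Sum>i<m. \<Sum>j<m. b n (matrix_unit i j) * a n (unit j) i) sums (\<Sum>i<m. \<Sum>j<m. matrix_unit i j (unit j) i)"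
    by (intro sums_sum frame_coefficients frame matrix_unit_vecs)
  then have trace: "(\<Sum>n. \<Sum>i<m. \<Sum>j<m. b n (matrix_unit i j) * a n (unit j) i) = of_nat (m * m)"
    using unit_vecs[OF p1] by (simp add: sums_iff matrix_unit_apply unit_def)
  have bound: "norm (\<Sum>i<m. \<Sum>j<m. b n (matrix_unit i j) * a n (unit j) i) \<le> w n" for n
  proof -
    let ?\<beta> = "sqrt (\<Sum>i<m. \<Sum>j<m. (norm (b n (matrix_unit i j)))\<^sup>2)"
    let ?\<alpha> = "sqrt (\<Sum>i<m. \<Sum>j<m. (norm (a n (unit j) i))\<^sup>2)"
    let ?I = "{..<m} \<times> {..<m}"
    have "norm (\<Sum>i<m. \<Sum>j<m. b n (matrix_unit i j) * a n (unit j) i)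
        \<le> (\<Sum>(i,j)\<in>?I. \<bar>norm (b n (matrix_unit i j))\<bar> * \<bar>norm (a n (unit j) i)\<bar>)"
      unfolding sum.cartesian_product
      by (rule order_trans[OF norm_sum]) (simp add: norm_mult split_beta)
    also have "\<dots> \<le> L2_set (\<lambda>(i,j). norm (b n (matrix_unit i j))) ?I * L2_set (\<lambda>(i,j). norm (a n (unit j) i)) ?I"
      using L2_set_mult_ineq[of "\<lambda>(i,j). norm (b n (matrix_unit i j))" "\<lambda>(i,j). norm (a n (unit j) i)" ?I]
      by (simp add: split_beta)
    also have "\<dots> = ?\<beta> * ?\<alpha>"
      by (simp add: L2_set_def sum.cartesian_product split_beta)
    finally have 1: "norm (\<Sum>i<m. \<Sum>j<m. b n (matrix_unit i j) * a n (unit j) i) \<le> ?\<beta> * ?\<alpha>" .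
    have h1: "4 ^ m * ?\<beta> \<le> 4 * (\<Sum>z\<in>Z. norm (b n (signed_walsh k z)))"
      unfolding Z_def m_def by (rule hilbert_schmidt_walsh[OF b])
    have h2: "4 ^ m * ?\<alpha> \<le> 4 * (\<Sum>z'\<in>Z. norm (sign_functional m z' (a n)))"
      unfolding Z_def by (rule hilbert_schmidt_signs[OF a])
    have "(4 ^ m * ?\<beta>) * (4 ^ m * ?\<alpha>)
        \<le> (4 * (\<Sum>z\<in>Z. norm (b n (signed_walsh k z)))) * (4 * (\<Sum>z'\<in>Z. norm (sign_functional m z' (a n))))"
      by (rule mult_mono[OF h1 h2]) (simp_all add: sum_nonneg)
    also have "\<dots> = 16 * (\<Sum>z\<in>Z. \<Sum>z'\<in>Z. t n z z')"
      by (simp add: t_def sum_product)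
    also have "(4 ^ m * ?\<beta>) * (4 ^ m * ?\<alpha>) = 16 ^ m * (?\<beta> * ?\<alpha>)"
      by (simp add: mult_ac flip: power_mult_distrib)
    finally have "?\<beta> * ?\<alpha> \<le> w n" by (simp add: w_def field_simps)
    then show ?thesis using 1 by simp
  qed
  have sw: "summable w" unfolding w_def using t by (intro summable_mult summable_sum)
  have "real (m * m) = norm (\<Sum>n. \<Sum>i<m. \<Sum>j<m. b n (matrix_unit i j) * a n (unit j) i)"
    unfolding trace by (simp only: norm_of_nat)
  also have "\<dots> \<le> suminf w" by (rule norm_suminf_le[OF bound sw])
  also have "suminf w = 16 / 16 ^ m * (\<Sum>n. \<Sum>z\<in>Z. \<Sum>z'\<in>Z. t n z z')"
    unfolding w_def using t by (intro suminf_mult summable_sum)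
  \<comment> \<open>The series is moved inside because the Besselian bound concerns one vector and
    one functional, hence a fixed pair \<open>z\<close>, \<open>z'\<close>.\<close>
  also have "(\<Sum>n. \<Sum>z\<in>Z. \<Sum>z'\<in>Z. t n z z') = (\<Sum>z\<in>Z. \<Sum>n. \<Sum>z'\<in>Z. t n z z')"
    using t by (intro suminf_sum summable_sum)
  also have "\<dots> = (\<Sum>z\<in>Z. \<Sum>z'\<in>Z. \<Sum>n. t n z z')"
    using t by (intro sum.cong refl suminf_sum)
  also have "16 / 16 ^ m * (\<Sum>z\<in>Z. \<Sum>z'\<in>Z. \<Sum>n. t n z z') \<le> 16 / 16 ^ m * (\<Sum>z\<in>Z. \<Sum>z'\<in>Z. B * G * F)"
    using t by (intro mult_left_mono sum_mono) auto
  also have "\<dots> = 16 * B * (G * F)"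
  proof -
    have "(16::real) ^ m = 4 ^ m * 4 ^ m" by (simp flip: power_mult_distrib)
    then show ?thesis by (simp add: Z(2))
  qed
  finally have "real m powr 2 \<le> 16 * B * (G * F)" by (simp add: power2_eq_square)
  then show ?thesis unfolding G_def F_def powr_add[symmetric] by (simp only: m_def of_nat_power of_nat_numeral)
qed

lemma not_besselian: "\<not> besselian_schauder_frame E a b"
proof
  assume "besselian_schauder_frame E a b"
  then obtain B where frame: "schauder_frame E a b" and B: "0 < B"
    and bess: "\<forall>x\<in>vecs E. \<forall>y\<in>vecs (dual E).
       summable (\<lambda>n. norm (b n x) * norm (y (a n))) \<and>
       (\<Sum>n. norm (b n x) * norm (y (a n))) \<le> B * vnorm E x * vnorm (dual E) y"
    unfolding besselian_schauder_frame_def by blast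
  define \<theta> where "\<theta> = 1/2 + max 0 (1/q - 1/2) + max 0 (1/2 - 1/p) + (1/p + 1 - 1/q)"
  have "1/p < 1/q" "1/q < 1" "0 < 1/p" using p q by (auto simp: field_simps)
  \<comment> \<open>The exponent is \<open>3/2\<close> if \<open>q <= 2 <= p\<close>,
    \<open>1 + 1/p\<close> if \<open>p <= 2\<close>, and \<open>2 - 1/q\<close> if
    \<open>q >= 2\<close>.\<close>
  then have "\<theta> < 2" unfolding \<theta>_def by linarith
  then have "1 < 2 powr (2 - \<theta>)" by simp
  \<comment> \<open>Powers of \<open>2 powr (2 - \<theta>)\<close> outgrow the constant
    \<open>16 * B\<close>, so a large enough Walsh matrix violates the trace bound.\<close>
  then obtain k where k: "16 * B < (2 powr (2 - \<theta>)) ^ k" using real_arch_pow by blast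
  have "(2 ^ k) powr 2 \<le> 16 * B * (2 ^ k) powr \<theta>"
    using besselian_trace_bound[OF frame bess[rule_format] B] by (simp add: \<theta>_def)
  also have "\<dots> < (2 powr (2 - \<theta>)) ^ k * (2 ^ k) powr \<theta>" using k by simp
  also have "\<dots> = (2 ^ k) powr 2"
    by (simp add: powr_power powr_realpow[symmetric] powr_powr powr_add[symmetric] algebra_simps del: powr_numeral)
  finally show False by simp
qed

lemma not_unconditional: "\<not> unconditional_schauder_frame E a b"
proof -
  have "normed_nspace.complete_nspace E" unfolding E_def by (rule PQ.complete_compact_ops)
  then show ?thesis using unconditional_imp_besselian[OF E.normed_nspace_axioms] not_besselian by blast
qed

end

theorem corollary6:
  fixes p q :: real
  assumes "p > q" and "q > 1"
  defines "E \<equiv> compact_ops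
             (lspace p :: ('k::{real_normed_field, euclidean_space}, nat \<Rightarrow> 'k) nspace) (lspace q)"
  shows "\<not> (\<exists>a b. besselian_schauder_frame E a b) \<and>
         \<not> (\<exists>a b. unconditional_schauder_frame E a b)"
proof -
  interpret lspace_operators p q E
    by unfold_locales (use assms(1,2) in \<open>auto simp: E_def\<close>)
  show ?thesis using not_besselian not_unconditional by blast
qed

end
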